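(* Let $(\mu_k,w_k)\in L^\infty(\mathscr D)\times L^3(\mathscr D;\mathbb R^n)$, $k\in\mathbb N$, be a sequence of solutions of $$\partial_t(\mu_kw_k)+\mathrm{div}(\mu_kw_k\otimes w_k)+\nabla q_k=0,\quad\mathrm{div}\,w_k=0,\quad\partial_t\mu_k+\mathrm{div}(\mu_kw_k)=0,$$ $$\partial_t\left(\tfrac12\mu_k|w_k|^2\right)+\mathrm{div}\left(\left(\tfrac12\mu_k|w_k|^2+q_k\right)w_k\right)=\nu_k\le0$$ on $\mathscr D$ with pressures $q_k$, dissipation measures $\nu_k$, and $\mu_k\in\{\rho_-,\rho_+\}$ almost everywhere. Define $z_k=(\mu_k,w_k,m_k,h_k,\sigma_k,e_k)$ by $m_k=\mu_kw_k$, $h_k=(e_k+q_k)w_k$, $\mu_kw_k\otimes w_k=\sigma_k+\frac2ne_k\,\mathrm{id}$ with $\sigma_k$ traceless. If $z_k$ and $q_k$ converge weakly in $L^1(\mathscr D)$ to an integrable tuple $\bar z=(\bar\mu,\bar w,\bar m,\bar h,\bar\sigma,\bar e)$ and $\bar q\in L^1(\mathscr D)$, and if $\nu_k$ converges weakly to another measure $\bar\nu$, then $\bar z$ solves $$\partial_t\bar m+\mathrm{div}\,\bar\sigma+\nabla\left(\tfrac2n\bar e+\bar q\right)=0,\quad\mathrm{div}\,\bar w=0,\quad\partial_t\bar\mu+\mathrm{div}\,\bar m=0,\quad\partial_t\bar e+\mathrm{div}\,\bar h=\bar\nu.$$ Moreover, $\bar z$ takes pointwise almost everywhere values in the closure of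 the set $$\left\{z\in Z:\rho_-<\mu<\rho_+,\ \lambda_{\max}(\tilde M(z))<\tfrac2ne\right\}.$$ If $\|w_k\|_{L^\infty(\mathscr D;\mathbb R^n)}$ is uniformly bounded along the sequence, then in addition $T_-(\bar z),T_+(\bar z)\in L^\infty$ with $$\|T_\pm(\bar z)\|_{L^\infty}\le\frac{\rho_+}2\sup_k\|w_k\|^2_{L^\infty(\mathscr D;\mathbb R^n)},$$ where $T_\pm(\bar z)$ is considered on the set $\{\bar\mu\in(\rho_-,\rho_+)\}\subset\mathscr D$ on which it is defined.
   Context: $n\in\{2,3\}$, $g>0$, $T>0$, $0<\rho_-<\rho_+$; $\Omega$ is a bounded domain in $\mathbb R^n$ or $\mathbb T^{n-1}\times(-L,L)$; $\mathscr D=\{(y,t):t\in(0,T),\ y\in\Omega+\frac12gt^2e_n\}$. $Z=\mathbb R\times\mathbb R^n\times\mathbb R^n\times\mathbb R^n\times\mathcal S_0^{n\times n}\times\mathbb R\ni z=(\mu,w,m,h,\sigma,e)$, where $\mathcal S_0^{n\times n}$ are the symmetric traceless matrices; $\lambda_{\max}$ is the largest eigenvalue. For $z\in Z$ with $\mu\in(\rho_-,\rho_+)$, $$\tilde M(z)=\frac{\mu\rho_-\rho_+w\otimes w-\rho_-\rho_+(m\otimes w+w\otimes m)+(\rho_++\rho_--\mu)m\otimes m}{(\rho_+-\mu)(\mu-\rho_-)}-\sigma,\qquad T_\pm(z)=\frac{\rho_\pm}2\frac{|m-\rho_\mp w|^2}{(\mu-\rho_\mp)^2}.$$ Equations are understood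 in the sense of distributions on $\mathscr D$; weak convergence of the measures $\nu_k$ is convergence when tested against compactly supported continuous functions. *)

theory Defs
  imports "HOL-Probability.Essential_Supremum"
begin

section \<open>The space-time domain\<close>

text \<open>
  The index type \<open>'n\<close> has \<open>n\<close> elements and \<open>N :: 'n\<close> is the label of the vertical (last)
  coordinate, so that \<open>axis N 1\<close> is \<open>e_n\<close>. A container is either a bounded domain of
  \<open>real ^ 'n\<close> or \<open>(\<real>/a\<int>)^(n-1) \<times> (-L,L)\<close>. The second kind is described by its covering strip,
  the lattice of horizontal periods, and a fundamental cell. (Classes of) functions and Borel
  measures on the quotient are functions and measures on the part of the covering lying over the
  cell; only the continuity of test functions and compactness refer to the covering. For a bounded
  domain the covering is trivial.
\<close>

datatype 'n container = Bounded_Domain "(real ^ 'n) set" | Torus_Strip real real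

type_synonym 'n point = "(real ^ 'n) \<times> real"

fun admissible_container :: "'n::finite container \<Rightarrow> bool" where
  "admissible_container (Bounded_Domain \<Omega>) \<longleftrightarrow> open \<Omega> \<and> connected \<Omega> \<and> \<Omega> \<noteq> {} \<and> bounded \<Omega>"
| "admissible_container (Torus_Strip a L) \<longleftrightarrow> 0 < a \<and> 0 < L"

fun covering :: "'n::finite \<Rightarrow> 'n container \<Rightarrow> (real ^ 'n) set" where
  "covering N (Bounded_Domain \<Omega>) = \<Omega>"
| "covering N (Torus_Strip a L) = {y. - L < y $ N \<and> y $ N < L}"

fun periods :: "'n::finite \<Rightarrow> 'n container \<Rightarrow> (real ^ 'n) set" where
  "periods N (Bounded_Domain \<Omega>) = {0}"
| "periods N (Torus_Strip a L) = {l. l $ N = 0 \<and> (\<forall>i. \<exists>k::int. l $ i = of_int k * a)}"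

fun fundamental_cell :: "'n::finite \<Rightarrow> 'n container \<Rightarrow> (real ^ 'n) set" where
  "fundamental_cell N (Bounded_Domain \<Omega>) = UNIV"
| "fundamental_cell N (Torus_Strip a L) = {y. \<forall>i. i \<noteq> N \<longrightarrow> 0 \<le> y $ i \<and> y $ i < a}"

definition spacetime_covering ::
  "'n::finite \<Rightarrow> real \<Rightarrow> real \<Rightarrow> 'n container \<Rightarrow> 'n point set" where
  "spacetime_covering N g T C =
     {(y, t). 0 < t \<and> t < T \<and> y - (1/2 * g * t\<^sup>2) *\<^sub>R axis N 1 \<in> covering N C}"

definition spacetime :: "'n::finite \<Rightarrow> real \<Rightarrow> real \<Rightarrow> 'n container \<Rightarrow> 'n point set" where
  "spacetime N g T C = spacetime_covering N g T C \<inter> fundamental_cell N C \<times> UNIV"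


section \<open>Test functions and distributional derivatives\<close>

primrec Ck :: "nat \<Rightarrow> ('a::real_normed_vector \<Rightarrow> real) \<Rightarrow> bool" where
  "Ck 0 f \<longleftrightarrow> continuous_on UNIV f"
| "Ck (Suc k) f \<longleftrightarrow>
     (\<forall>x. f differentiable at x) \<and> (\<forall>v. Ck k (\<lambda>x. frechet_derivative f (at x) v))"

text \<open>
  Continuous functions with compact support in the space-time domain; in the periodic case these
  are lifted to the covering, where the support is compact modulo the periods.
\<close>

definition compactly_supported ::
  "'n::finite \<Rightarrow> real \<Rightarrow> real \<Rightarrow> 'n container \<Rightarrow> ('n point \<Rightarrow> real) \<Rightarrow> bool" where
  "compactly_supported N g T C \<phi> \<longleftrightarrow>
     continuous_on UNIV \<phi> \<and>
     (\<forall>l\<in>periods N C. \<forall>y t. \<phi> (y + l, t) = \<phi> (y, t)) \<and>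
     (\<exists>K. compact K \<and> K \<subseteq> spacetime_covering N g T C \<and>
        (\<forall>y t. \<phi> (y, t) \<noteq> 0 \<longrightarrow> (\<exists>l\<in>periods N C. (y + l, t) \<in> K)))"

definition test_function ::
  "'n::finite \<Rightarrow> real \<Rightarrow> real \<Rightarrow> 'n container \<Rightarrow> ('n point \<Rightarrow> real) \<Rightarrow> bool" where
  "test_function N g T C \<phi> \<longleftrightarrow> compactly_supported N g T C \<phi> \<and> (\<forall>k. Ck k \<phi>)"

definition time_deriv :: "('n::finite point \<Rightarrow> real) \<Rightarrow> 'n point \<Rightarrow> real" where
  "time_deriv \<phi> p = frechet_derivative \<phi> (at p) (0, 1)"

definition space_grad :: "('n::finite point \<Rightarrow> real) \<Rightarrow> 'n point \<Rightarrow> real ^ 'n" where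
  "space_grad \<phi> p = (\<chi> i. frechet_derivative \<phi> (at p) (axis i 1, 0))"

definition dist_dt ::
  "'n::finite point set \<Rightarrow> ('n point \<Rightarrow> 'b::euclidean_space) \<Rightarrow> ('n point \<Rightarrow> real) \<Rightarrow> 'b" where
  "dist_dt D u \<phi> = - (LINT p|lebesgue_on D. time_deriv \<phi> p *\<^sub>R u p)"

definition dist_div ::
  "'n::finite point set \<Rightarrow> ('n point \<Rightarrow> real ^ 'n) \<Rightarrow> ('n point \<Rightarrow> real) \<Rightarrow> real" where
  "dist_div D u \<phi> = - (LINT p|lebesgue_on D. u p \<bullet> space_grad \<phi> p)"

text \<open>Row-wise divergence of a matrix field; all matrix fields below are symmetric.\<close>

definition dist_div_mat ::
  "'n::finite point set \<Rightarrow> ('n point \<Rightarrow> real ^ 'n ^ 'n) \<Rightarrow> ('n point \<Rightarrow> real) \<Rightarrow> real ^ 'n" where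
  "dist_div_mat D S \<phi> = - (LINT p|lebesgue_on D. S p *v space_grad \<phi> p)"

definition dist_grad ::
  "'n::finite point set \<Rightarrow> ('n point \<Rightarrow> real) \<Rightarrow> ('n point \<Rightarrow> real) \<Rightarrow> real ^ 'n" where
  "dist_grad D q \<phi> = - (LINT p|lebesgue_on D. q p *\<^sub>R space_grad \<phi> p)"


section \<open>Signed measures on the space-time domain\<close>

text \<open>
  A signed Radon measure is represented by a pair \<open>(A, B)\<close> of locally finite Borel measures and
  stands for \<open>A - B\<close>, which is well defined on relatively compact sets although both parts may
  have infinite total mass.
\<close>

type_synonym 'n signed_measure = "'n point measure \<times> 'n point measure"

definition locally_finite_borel ::
  "'n::finite \<Rightarrow> real \<Rightarrow> real \<Rightarrow> 'n container \<Rightarrow> 'n point measure \<Rightarrow> bool" where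
  "locally_finite_borel N g T C M \<longleftrightarrow>
     sets M = sets (restrict_space borel (spacetime N g T C)) \<and>
     (\<forall>K. compact K \<longrightarrow> K \<subseteq> spacetime_covering N g T C \<longrightarrow>
        emeasure M (K \<inter> fundamental_cell N C \<times> UNIV) < \<infinity>)"

definition signed_radon ::
  "'n::finite \<Rightarrow> real \<Rightarrow> real \<Rightarrow> 'n container \<Rightarrow> 'n signed_measure \<Rightarrow> bool" where
  "signed_radon N g T C \<nu> \<longleftrightarrow>
     locally_finite_borel N g T C (fst \<nu>) \<and> locally_finite_borel N g T C (snd \<nu>)"

definition nonpositive :: "'n::finite signed_measure \<Rightarrow> bool" where
  "nonpositive \<nu> \<longleftrightarrow> (\<forall>A\<in>sets (fst \<nu>). emeasure (fst \<nu>) A \<le> emeasure (snd \<nu>) A)"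

definition measure_pairing :: "'n::finite signed_measure \<Rightarrow> ('n point \<Rightarrow> real) \<Rightarrow> real" where
  "measure_pairing \<nu> \<phi> = (LINT p|fst \<nu>. \<phi> p) - (LINT p|snd \<nu>. \<phi> p)"

definition weakly_converges_measure :: "'n::finite \<Rightarrow> real \<Rightarrow> real \<Rightarrow> 'n container \<Rightarrow>
    (nat \<Rightarrow> 'n signed_measure) \<Rightarrow> 'n signed_measure \<Rightarrow> bool" where
  "weakly_converges_measure N g T C \<nu> \<nu>b \<longleftrightarrow>
     (\<forall>\<phi>. compactly_supported N g T C \<phi> \<longrightarrow>
        (\<lambda>k. measure_pairing (\<nu> k) \<phi>) \<longlonglongrightarrow> measure_pairing \<nu>b \<phi>)"


section \<open>Lebesgue spaces\<close>

definition linf_norm :: "'a measure \<Rightarrow> ('a \<Rightarrow> 'b::real_normed_vector) \<Rightarrow> ennreal" where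
  "linf_norm M f = esssup M (\<lambda>x. ennreal (norm (f x)))"

definition in_Linf :: "'a measure \<Rightarrow> ('a \<Rightarrow> 'b::real_normed_vector) \<Rightarrow> bool" where
  "in_Linf M f \<longleftrightarrow> f \<in> borel_measurable M \<and> linf_norm M f < \<infinity>"

definition in_Lp :: "nat \<Rightarrow> 'a measure \<Rightarrow> ('a \<Rightarrow> 'b::real_normed_vector) \<Rightarrow> bool" where
  "in_Lp r M f \<longleftrightarrow> f \<in> borel_measurable M \<and> integrable M (\<lambda>x. norm (f x) ^ r)"

definition weakly_converges_L1 ::
  "'a measure \<Rightarrow> (nat \<Rightarrow> 'a \<Rightarrow> 'b::euclidean_space) \<Rightarrow> ('a \<Rightarrow> 'b) \<Rightarrow> bool" where
  "weakly_converges_L1 M f fb \<longleftrightarrow>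
     (\<forall>k. integrable M (f k)) \<and> integrable M fb \<and>
     (\<forall>\<psi>. in_Linf M \<psi> \<longrightarrow> (\<lambda>k. LINT x|M. \<psi> x \<bullet> f k x) \<longlonglongrightarrow> (LINT x|M. \<psi> x \<bullet> fb x))"


section \<open>States\<close>

type_synonym 'n state =
  "real \<times> (real ^ 'n) \<times> (real ^ 'n) \<times> (real ^ 'n) \<times> (real ^ 'n ^ 'n) \<times> real"

definition outer :: "real ^ 'n \<Rightarrow> real ^ 'n \<Rightarrow> real ^ 'n::finite ^ 'n" where
  "outer u v = (\<chi> i j. u $ i * v $ j)"

definition sym_traceless :: "(real ^ 'n::finite ^ 'n) set" where
  "sym_traceless = {\<sigma>. transpose \<sigma> = \<sigma> \<and> trace \<sigma> = 0}"

definition Z_space :: "'n::finite state set" where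
  "Z_space = UNIV \<times> UNIV \<times> UNIV \<times> UNIV \<times> sym_traceless \<times> UNIV"

definition lambda_max :: "real ^ 'n::finite ^ 'n \<Rightarrow> real" where
  "lambda_max A = Max {l. \<exists>v. v \<noteq> 0 \<and> A *v v = l *\<^sub>R v}"

text \<open>Throughout, \<open>\<rho>m\<close> is \<open>\<rho>_-\<close> and \<open>\<rho>p\<close> is \<open>\<rho>_+\<close>.\<close>

definition M_tilde :: "real \<Rightarrow> real \<Rightarrow> 'n::finite state \<Rightarrow> real ^ 'n ^ 'n" where
  "M_tilde \<rho>m \<rho>p z = (case z of (\<mu>, w, m, h, \<sigma>, e) \<Rightarrow>
     (1 / ((\<rho>p - \<mu>) * (\<mu> - \<rho>m))) *\<^sub>R
       ((\<mu> * \<rho>m * \<rho>p) *\<^sub>R outer w w - (\<rho>m * \<rho>p) *\<^sub>R (outer m w + outer w m)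
         + (\<rho>p + \<rho>m - \<mu>) *\<^sub>R outer m m) - \<sigma>)"

definition T_plus :: "real \<Rightarrow> real \<Rightarrow> 'n::finite state \<Rightarrow> real" where
  "T_plus \<rho>m \<rho>p z = (case z of (\<mu>, w, m, h, \<sigma>, e) \<Rightarrow>
     \<rho>p / 2 * ((norm (m - \<rho>m *\<^sub>R w))\<^sup>2 / (\<mu> - \<rho>m)\<^sup>2))"

definition T_minus :: "real \<Rightarrow> real \<Rightarrow> 'n::finite state \<Rightarrow> real" where
  "T_minus \<rho>m \<rho>p z = (case z of (\<mu>, w, m, h, \<sigma>, e) \<Rightarrow>
     \<rho>m / 2 * ((norm (m - \<rho>p *\<^sub>R w))\<^sup>2 / (\<mu> - \<rho>p)\<^sup>2))"

definition relaxation_set :: "real \<Rightarrow> real \<Rightarrow> 'n::finite state set" where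
  "relaxation_set \<rho>m \<rho>p = {z \<in> Z_space. case z of (\<mu>, w, m, h, \<sigma>, e) \<Rightarrow>
     \<rho>m < \<mu> \<and> \<mu> < \<rho>p \<and> lambda_max (M_tilde \<rho>m \<rho>p z) < 2 / real CARD('n) * e}"


section \<open>The two systems\<close>

definition euler_solution :: "'n::finite \<Rightarrow> real \<Rightarrow> real \<Rightarrow> 'n container \<Rightarrow>
    ('n point \<Rightarrow> real) \<Rightarrow> ('n point \<Rightarrow> real ^ 'n) \<Rightarrow> ('n point \<Rightarrow> real) \<Rightarrow>
    'n signed_measure \<Rightarrow> bool" where
  "euler_solution N g T C \<mu> w q \<nu> \<longleftrightarrow>
     (let D = spacetime N g T C in
      signed_radon N g T C \<nu> \<and> nonpositive \<nu> \<and>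
      (\<forall>\<phi>. test_function N g T C \<phi> \<longrightarrow>
         dist_dt D (\<lambda>p. \<mu> p *\<^sub>R w p) \<phi> + dist_div_mat D (\<lambda>p. \<mu> p *\<^sub>R outer (w p) (w p)) \<phi>
           + dist_grad D q \<phi> = 0 \<and>
         dist_div D w \<phi> = 0 \<and>
         dist_dt D \<mu> \<phi> + dist_div D (\<lambda>p. \<mu> p *\<^sub>R w p) \<phi> = 0 \<and>
         dist_dt D (\<lambda>p. 1/2 * \<mu> p * (norm (w p))\<^sup>2) \<phi>
           + dist_div D (\<lambda>p. (1/2 * \<mu> p * (norm (w p))\<^sup>2 + q p) *\<^sub>R w p) \<phi>
           = measure_pairing \<nu> \<phi>))"

definition relaxed_solution :: "'n::finite \<Rightarrow> real \<Rightarrow> real \<Rightarrow> 'n container \<Rightarrow>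
    ('n point \<Rightarrow> 'n state) \<Rightarrow> ('n point \<Rightarrow> real) \<Rightarrow> 'n signed_measure \<Rightarrow> bool" where
  "relaxed_solution N g T C z q \<nu> \<longleftrightarrow>
     (let D = spacetime N g T C;
          \<mu> = (\<lambda>p. case z p of (\<mu>, w, m, h, \<sigma>, e) \<Rightarrow> \<mu>);
          w = (\<lambda>p. case z p of (\<mu>, w, m, h, \<sigma>, e) \<Rightarrow> w);
          m = (\<lambda>p. case z p of (\<mu>, w, m, h, \<sigma>, e) \<Rightarrow> m);
          h = (\<lambda>p. case z p of (\<mu>, w, m, h, \<sigma>, e) \<Rightarrow> h);
          \<sigma> = (\<lambda>p. case z p of (\<mu>, w, m, h, \<sigma>, e) \<Rightarrow> \<sigma>);
          e = (\<lambda>p. case z p of (\<mu>, w, m, h, \<sigma>, e) \<Rightarrow> e)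
      in \<forall>\<phi>. test_function N g T C \<phi> \<longrightarrow>
         dist_dt D m \<phi> + dist_div_mat D \<sigma> \<phi>
           + dist_grad D (\<lambda>p. 2 / real CARD('n) * e p + q p) \<phi> = 0 \<and>
         dist_div D w \<phi> = 0 \<and>
         dist_dt D \<mu> \<phi> + dist_div D m \<phi> = 0 \<and>
         dist_dt D e \<phi> + dist_div D h \<phi> = measure_pairing \<nu> \<phi>)"

end

theory Submission
  imports Defs
begin

text \<open>
  The relaxed system is linear in the state, the pressure and the dissipation measure, and every
  Euler flow, rewritten in the variables \<open>z\<close>, solves it (\<open>euler_solution_imp_relaxed_solution\<close>). A
  derivative of a test function is bounded, hence is an admissible multiplier for weak convergence in
  \<open>L\<^sup>1\<close>, and each equation passes to the limit (\<open>relaxed_solution_weak_limit\<close>). The nonlinearity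
  survives only in the pointwise constraint that the states are Euler states.

  What remains of a pointwise constraint under weak convergence is its closed convex hull: if all
  members of a weakly convergent sequence take values almost everywhere in a closed convex set, so
  does the limit (\<open>weak_limit_AE_closed_convex\<close>). Both remaining claims apply this to a suitable set.

  For the first, the relaxation set is convex (\<open>convex_relaxation_set\<close>). By the Rayleigh principle
  (\<open>lambda_max_less_iff\<close>) its eigenvalue condition is a family of scalar inequalities, one for each
  direction \<open>v\<close>, and \<open>v \<bullet> M_tilde v\<close> equals, up to the linear term in \<open>\<sigma>\<close>, a combination with
  positive coefficients of two terms \<open>x\<^sup>2 / a\<close> in which \<open>x\<close> is linear and \<open>a > 0\<close> affine in the state
  (\<open>inner_M_tilde\<close>); such terms are jointly convex. The Euler states lie in the closure
  (\<open>euler_state_in_closure_relaxation_set\<close>).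

  For the second, if \<open>|w| \<le> W\<close> then Euler states satisfy \<open>|m - \<rho>m w| \<le> W (\<mu> - \<rho>m)\<close> and
  \<open>|m - \<rho>p w| \<le> W (\<rho>p - \<mu>)\<close>, one of the two reading \<open>0 \<le> 0\<close>. These are closed convex conditions,
  and for a mixed state they say exactly that the two velocities entering \<open>T_\<plusminus>\<close> are bounded by \<open>W\<close>.
\<close>

section \<open>Weak convergence in \<open>L\<^sup>1\<close>\<close>

lemma in_Linf_I:
  assumes "f \<in> borel_measurable M" and "AE x in M. norm (f x) \<le> B"
  shows "in_Linf M f"
proof -
  have "linf_norm M f \<le> ennreal B"
    unfolding linf_norm_def using assms by (intro esssup_I) (auto intro: ennreal_leI)
  then show ?thesis
    using assms(1) by (auto simp: in_Linf_def intro: le_less_trans)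
qed

lemma in_Linf_E:
  assumes "in_Linf M f"
  obtains B where "0 \<le> B" and "AE x in M. norm (f x) \<le> B"
proof
  have fin: "linf_norm M f < \<infinity>" using assms by (simp add: in_Linf_def)
  have "AE x in M. ennreal (norm (f x)) \<le> linf_norm M f"
    unfolding linf_norm_def by (rule esssup_AE)
  then show "AE x in M. norm (f x) \<le> enn2real (linf_norm M f)"
  proof eventually_elim
    case (elim x)
    then have "enn2real (ennreal (norm (f x))) \<le> enn2real (linf_norm M f)"
      using fin by (intro enn2real_mono) auto
    then show ?case by simp
  qed
qed simp

lemma in_Linf_bounded_linear:
  assumes "bounded_linear G" and "in_Linf M f"
  shows "in_Linf M (\<lambda>x. G (f x))"
proof -
  obtain B where B: "AE x in M. norm (f x) \<le> B" using assms(2) by (rule in_Linf_E)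
  obtain K where K: "0 \<le> K" "\<And>x. norm (G x) \<le> norm x * K"
    using bounded_linear.nonneg_bounded[OF assms(1)] by blast
  have "AE x in M. norm (G (f x)) \<le> B * K"
    using B by eventually_elim (use K in \<open>meson mult_right_mono order_trans\<close>)
  moreover have "(\<lambda>x. G (f x)) \<in> borel_measurable M"
    using assms(2) by (intro borel_measurable_continuous_on[OF linear_continuous_on[OF assms(1)]])
      (simp add: in_Linf_def)
  ultimately show ?thesis by (rule in_Linf_I[rotated])
qed

lemma integrable_bilinear_Linf:
  fixes pr :: "'b::euclidean_space \<Rightarrow> 'c::euclidean_space \<Rightarrow> 'd::euclidean_space"
  assumes bil: "bounded_bilinear pr" and \<psi>: "in_Linf M \<psi>" and f: "integrable M f"
  shows "integrable M (\<lambda>x. pr (f x) (\<psi> x))"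
proof -
  obtain B where B: "0 \<le> B" "AE x in M. norm (\<psi> x) \<le> B" using \<psi> by (rule in_Linf_E)
  obtain K where K: "0 \<le> K" "\<And>a b. norm (pr a b) \<le> norm a * norm b * K"
    using bounded_bilinear.nonneg_bounded[OF bil] by blast
  show ?thesis
  proof (rule Bochner_Integration.integrable_bound)
    show "integrable M (\<lambda>x. K * B * norm (f x))" using f by simp
    have "f \<in> borel_measurable M" "\<psi> \<in> borel_measurable M"
      using f \<psi> by (auto simp: in_Linf_def)
    moreover have "continuous_on UNIV (\<lambda>p. pr (fst p) (snd p))"
      by (rule bounded_bilinear.continuous_on[OF bil]) (intro continuous_intros)+
    ultimately show "(\<lambda>x. pr (f x) (\<psi> x)) \<in> borel_measurable M"
      by (rule borel_measurable_continuous_Pair)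
    show "AE x in M. norm (pr (f x) (\<psi> x)) \<le> norm (K * B * norm (f x))"
      using B(2)
    proof eventually_elim
      fix x assume x: "norm (\<psi> x) \<le> B"
      have "norm (pr (f x) (\<psi> x)) \<le> norm (f x) * norm (\<psi> x) * K" by (rule K)
      also have "\<dots> \<le> norm (f x) * B * K"
        using x K by (intro mult_right_mono mult_left_mono) auto
      also have "\<dots> = norm (K * B * norm (f x))" using K B by (simp add: abs_mult)
      finally show "norm (pr (f x) (\<psi> x)) \<le> norm (K * B * norm (f x))" .
    qed
  qed
qed

text \<open>
  Weak convergence is tested with inner products only. Each coordinate of a bilinear expression in
  \<open>f k\<close> and a bounded \<open>\<psi>\<close> is such an inner product: \<open>pr u y \<bullet> b = G y \<bullet> u\<close> with a linear \<open>G\<close>,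
  and \<open>G \<circ> \<psi>\<close> is again bounded.
\<close>

lemma weakly_converges_L1_bilinear:
  fixes pr :: "'b::euclidean_space \<Rightarrow> 'c::euclidean_space \<Rightarrow> 'd::euclidean_space"
  assumes bil: "bounded_bilinear pr" and \<psi>: "in_Linf M \<psi>" and f: "weakly_converges_L1 M f fb"
  shows "(\<lambda>k. LINT x|M. pr (f k x) (\<psi> x)) \<longlonglongrightarrow> (LINT x|M. pr (fb x) (\<psi> x))"
proof (subst tendsto_componentwise_iff, rule ballI)
  interpret bounded_bilinear pr by (rule bil)
  have int: "integrable M (f k)" "integrable M fb" for k
    using f by (auto simp: weakly_converges_L1_def)
  fix b :: 'd assume "b \<in> Basis"
  define G where "G y = (\<Sum>c\<in>Basis. (pr c y \<bullet> b) *\<^sub>R c)" for y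
  have G: "bounded_linear G"
    unfolding G_def
    by (intro bounded_linear_sum bounded_linear_compose[OF bounded_linear_scaleR_left]
        bounded_linear_compose[OF bounded_linear_inner_left] bounded_linear_right)
  have adj: "pr u y \<bullet> b = G y \<bullet> u" for u y
  proof -
    have "pr u y = pr (\<Sum>c\<in>Basis. (u \<bullet> c) *\<^sub>R c) y" by (simp add: euclidean_representation)
    also have "\<dots> = (\<Sum>c\<in>Basis. (u \<bullet> c) *\<^sub>R pr c y)" by (simp add: sum_left scaleR_left)
    finally show ?thesis
      unfolding G_def by (simp add: inner_sum_left inner_commute[of u] mult.commute)
  qed
  have comp: "(LINT x|M. pr (g x) (\<psi> x)) \<bullet> b = (LINT x|M. G (\<psi> x) \<bullet> g x)"
    if "integrable M g" for g
    using integral_inner_left[of b, OF integrable_bilinear_Linf[OF bil \<psi> that]]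
    unfolding adj by simp
  have "in_Linf M (\<lambda>x. G (\<psi> x))" by (rule in_Linf_bounded_linear[OF G \<psi>])
  then have "(\<lambda>k. LINT x|M. G (\<psi> x) \<bullet> f k x) \<longlonglongrightarrow> (LINT x|M. G (\<psi> x) \<bullet> fb x)"
    using f by (auto simp: weakly_converges_L1_def)
  then show "(\<lambda>k. (LINT x|M. pr (f k x) (\<psi> x)) \<bullet> b) \<longlonglongrightarrow> (LINT x|M. pr (fb x) (\<psi> x)) \<bullet> b"
    by (simp add: comp int)
qed

lemma weakly_converges_L1_bounded_linear:
  fixes L :: "'b::euclidean_space \<Rightarrow> 'c::euclidean_space"
  assumes L: "bounded_linear L" and f: "weakly_converges_L1 M f fb"
  shows "weakly_converges_L1 M (\<lambda>k x. L (f k x)) (\<lambda>x. L (fb x))"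
  unfolding weakly_converges_L1_def
proof (intro conjI allI impI)
  show "integrable M (\<lambda>x. L (f k x))" for k
    using f by (intro integrable_bounded_linear[OF L]) (simp add: weakly_converges_L1_def)
  show "integrable M (\<lambda>x. L (fb x))"
    using f by (intro integrable_bounded_linear[OF L]) (simp add: weakly_converges_L1_def)
  fix \<psi> :: "'a \<Rightarrow> 'c" assume \<psi>: "in_Linf M \<psi>"
  have "bounded_bilinear (\<lambda>u y. L u \<bullet> y)"
    by (rule bounded_bilinear.comp1[OF bounded_bilinear_inner L])
  from weakly_converges_L1_bilinear[OF this \<psi> f]
  show "(\<lambda>k. LINT x|M. \<psi> x \<bullet> L (f k x)) \<longlonglongrightarrow> (LINT x|M. \<psi> x \<bullet> L (fb x))"
    by (simp add: inner_commute)
qed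

lemma weakly_converges_L1_add:
  assumes f: "weakly_converges_L1 M f fb" and g: "weakly_converges_L1 M g gb"
  shows "weakly_converges_L1 M (\<lambda>k x. f k x + g k x) (\<lambda>x. fb x + gb x)"
  unfolding weakly_converges_L1_def
proof (intro conjI allI impI)
  have int: "integrable M (f k)" "integrable M fb" "integrable M (g k)" "integrable M gb" for k
    using f g by (auto simp: weakly_converges_L1_def)
  show "integrable M (\<lambda>x. f k x + g k x)" for k using int by simp
  show "integrable M (\<lambda>x. fb x + gb x)" using int by simp
  fix \<psi> :: "'a \<Rightarrow> 'b" assume \<psi>: "in_Linf M \<psi>"
  have split: "(LINT x|M. \<psi> x \<bullet> (u x + v x)) = (LINT x|M. \<psi> x \<bullet> u x) + (LINT x|M. \<psi> x \<bullet> v x)"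
    if "integrable M u" "integrable M v" for u v
    using integrable_bilinear_Linf[OF bounded_bilinear_inner \<psi> that(1)]
      integrable_bilinear_Linf[OF bounded_bilinear_inner \<psi> that(2)]
    by (simp add: inner_add_right inner_commute[of "\<psi> _"])
  show "(\<lambda>k. LINT x|M. \<psi> x \<bullet> (f k x + g k x)) \<longlonglongrightarrow> (LINT x|M. \<psi> x \<bullet> (fb x + gb x))"
    using f g \<psi> by (auto simp: split int weakly_converges_L1_def intro: tendsto_add)
qed

text \<open>
  Testing with \<open>a\<close> times the indicator of a set of finite measure on which the inequality fails for
  the limit shows that this set is null; countably many such sets cover the whole space.
\<close>

lemma weak_limit_AE_halfspace:
  fixes f :: "nat \<Rightarrow> 'a \<Rightarrow> 'b::euclidean_space"
  assumes "sigma_finite_measure M" and f: "weakly_converges_L1 M f fb"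
    and le: "\<And>k. AE x in M. b \<le> a \<bullet> f k x"
  shows "AE x in M. b \<le> a \<bullet> fb x"
proof -
  interpret sigma_finite_measure M by fact
  obtain A :: "nat \<Rightarrow> 'a set" where A: "range A \<subseteq> sets M" "\<Union> (range A) = space M"
      "\<And>i. emeasure M (A i) \<noteq> \<infinity>"
    using sigma_finite by metis
  have intf: "integrable M (f k)" "integrable M fb" for k
    using f by (auto simp: weakly_converges_L1_def)
  then have [measurable]: "f k \<in> borel_measurable M" "fb \<in> borel_measurable M" for k by auto
  have "AE x in M. x \<in> A i \<longrightarrow> b \<le> a \<bullet> fb x" for i
  proof -
    define E where "E = {x \<in> space M. x \<in> A i \<and> a \<bullet> fb x < b}"
    have [measurable]: "A i \<in> sets M" using A(1) by auto
    have E[measurable]: "E \<in> sets M" unfolding E_def by measurable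
    have finE: "emeasure M E < \<infinity>"
    proof -
      have "emeasure M E \<le> emeasure M (A i)" by (rule emeasure_mono) (auto simp: E_def)
      also have "\<dots> < \<infinity>" using A(3)[of i] by (simp add: less_top)
      finally show ?thesis .
    qed
    define \<psi> where "\<psi> x = indicator E x *\<^sub>R a" for x
    have \<psi>: "in_Linf M \<psi>"
    proof (rule in_Linf_I[where B="norm a"])
      show "\<psi> \<in> borel_measurable M" unfolding \<psi>_def by measurable
    qed (simp add: \<psi>_def indicator_def)
    have intE: "integrable M (indicator E :: 'a \<Rightarrow> real)" using finE by simp
    have eq: "\<psi> x \<bullet> v = indicator E x * (a \<bullet> v)" for x v by (simp add: \<psi>_def)
    have int: "integrable M (\<lambda>x. \<psi> x \<bullet> g x)" if "integrable M g" for g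
      using integrable_bilinear_Linf[OF bounded_bilinear_inner \<psi> that] by (simp add: inner_commute)
    have "(LINT x|M. b * indicator E x) \<le> (LINT x|M. \<psi> x \<bullet> f k x)" for k
    proof (rule integral_mono_AE)
      show "AE x in M. b * indicator E x \<le> \<psi> x \<bullet> f k x"
        using le[of k] by eventually_elim (simp add: eq indicator_def)
    qed (use intE int intf in auto)
    moreover have "(\<lambda>k. LINT x|M. \<psi> x \<bullet> f k x) \<longlonglongrightarrow> (LINT x|M. \<psi> x \<bullet> fb x)"
      using f \<psi> by (simp add: weakly_converges_L1_def)
    ultimately have lim: "(LINT x|M. b * indicator E x) \<le> (LINT x|M. \<psi> x \<bullet> fb x)"
      by (intro LIMSEQ_le_const) auto
    define d where "d x = b * indicator E x - \<psi> x \<bullet> fb x" for x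
    have d: "integrable M d" unfolding d_def using intE int[OF intf(2)] by auto
    have d0: "0 \<le> d x" for x by (auto simp: d_def eq E_def indicator_def)
    have "integral\<^sup>L M d \<le> 0"
      using lim intE int[OF intf(2)] unfolding d_def
      by (subst Bochner_Integration.integral_diff) auto
    then have "integral\<^sup>L M d = 0" using d0 by (intro antisym integral_nonneg_AE) auto
    then have "AE x in M. d x = 0"
      using integral_nonneg_eq_0_iff_AE[OF d] d0 by auto
    then show ?thesis
      using AE_space
      by eventually_elim (auto simp: d_def eq E_def indicator_def split: if_splits)
  qed
  then have "AE x in M. \<forall>i. x \<in> A i \<longrightarrow> b \<le> a \<bullet> fb x"
    unfolding AE_all_countable by (rule allI)
  then show ?thesis
    using AE_space by eventually_elim (use A(2) in blast)
qed

text \<open>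
  A closed convex set is the intersection of the half-spaces containing it, and by the Lindelof
  property countably many of them suffice. Hence the almost everywhere statement for a single
  half-space passes to the set.
\<close>

lemma weak_limit_AE_closed_convex:
  fixes f :: "nat \<Rightarrow> 'a \<Rightarrow> 'b::euclidean_space"
  assumes M: "sigma_finite_measure M" and f: "weakly_converges_L1 M f fb"
    and K: "closed K" "convex K" and fK: "\<And>k. AE x in M. f k x \<in> K"
  shows "AE x in M. fb x \<in> K"
proof -
  define \<H> where "\<H> = {H. \<exists>a b. H = {x. a \<bullet> x < b} \<and> (\<forall>x\<in>K. b \<le> a \<bullet> x)}"
  have cover: "\<Union> \<H> = - K"
  proof (intro equalityI subsetI)
    fix x assume "x \<in> - K"
    then obtain a b where "a \<bullet> x < b" "\<forall>y\<in>K. a \<bullet> y > b"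
      using separating_hyperplane_closed_point[of K x] K by auto
    then have "{y. a \<bullet> y < b} \<in> \<H>" "x \<in> {y. a \<bullet> y < b}"
      unfolding \<H>_def by (auto intro: less_imp_le)
    then show "x \<in> \<Union> \<H>" by blast
  next
    fix x assume "x \<in> \<Union> \<H>"
    then obtain a b where "a \<bullet> x < b" "\<forall>y\<in>K. b \<le> a \<bullet> y" unfolding \<H>_def by blast
    then show "x \<in> - K" by (meson ComplI not_less)
  qed
  have "open H" if "H \<in> \<H>" for H
    using that by (auto simp: \<H>_def open_halfspace_lt)
  then obtain \<H>' where \<H>': "\<H>' \<subseteq> \<H>" "countable \<H>'" "\<Union>\<H>' = - K"
    unfolding cover[symmetric] by (rule Lindelof)
  have "AE x in M. fb x \<notin> H" if "H \<in> \<H>'" for H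
  proof -
    obtain a b where H: "H = {x. a \<bullet> x < b}" and ab: "\<forall>x\<in>K. b \<le> a \<bullet> x"
      using \<open>H \<in> \<H>'\<close> \<H>'(1) unfolding \<H>_def by blast
    have "AE x in M. b \<le> a \<bullet> f k x" for k
      using fK[of k] by eventually_elim (use ab in blast)
    from weak_limit_AE_halfspace[OF M f this] show ?thesis by (simp add: H not_less)
  qed
  then have "AE x in M. \<forall>H\<in>\<H>'. fb x \<notin> H" using \<H>'(2) by (simp add: AE_ball_countable)
  then show ?thesis by eventually_elim (use \<H>'(3) in blast)
qed

section \<open>The largest eigenvalue of a symmetric matrix\<close>

text \<open>
  Finiteness and (below) existence of eigenvalues make the \<open>Max\<close> in \<open>lambda_max\<close> an actual maximum;
  here eigenvectors for distinct eigenvalues are orthogonal.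
\<close>

lemma finite_eigenvalues_symmetric:
  fixes A :: "real ^ 'n::finite ^ 'n"
  assumes sym: "transpose A = A"
  shows "finite {l. \<exists>v. v \<noteq> 0 \<and> A *v v = l *\<^sub>R v}"
proof -
  let ?S = "{l. \<exists>v. v \<noteq> 0 \<and> A *v v = l *\<^sub>R v}"
  obtain f where f: "\<And>l. l \<in> ?S \<Longrightarrow> f l \<noteq> 0 \<and> A *v f l = l *\<^sub>R f l"
    using bchoice[of ?S "\<lambda>l v. v \<noteq> 0 \<and> A *v v = l *\<^sub>R v"] by blast
  have orth: "f k \<bullet> f l = 0" if "k \<in> ?S" "l \<in> ?S" "k \<noteq> l" for k l
  proof -
    have "(A *v f k) \<bullet> f l = f k \<bullet> (A *v f l)"
      using dot_lmul_matrix[of "f k" A "f l"] sym by (metis vector_transpose_matrix)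
    then have "k * (f k \<bullet> f l) = l * (f k \<bullet> f l)" using f that(1,2) by simp
    then show ?thesis using that(3) by simp
  qed
  have "pairwise orthogonal (f ` ?S)"
    using orth by (auto simp: pairwise_def orthogonal_def)
  then have "finite (f ` ?S)" by (rule pairwise_orthogonal_imp_finite)
  moreover have "inj_on f ?S"
  proof (rule inj_onI, rule ccontr)
    fix k l assume "k \<in> ?S" "l \<in> ?S" "f k = f l" "k \<noteq> l"
    then show False using orth[of k l] f[of l] by simp
  qed
  ultimately show ?thesis by (simp add: finite_image_iff)
qed

lemma Rayleigh_maximizer:
  fixes A :: "real ^ 'n::finite ^ 'n"
  assumes sym: "transpose A = A"
  obtains v l where "v \<noteq> 0" "A *v v = l *\<^sub>R v" "\<And>u. u \<bullet> (A *v u) \<le> l * (u \<bullet> u)"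
proof -
  have "continuous_on (sphere 0 1) (\<lambda>u. u \<bullet> (A *v u))"
    by (intro continuous_on_inner continuous_on_id linear_continuous_on
        matrix_vector_mul_bounded_linear)
  moreover have "(axis undefined 1 :: real ^ 'n) \<in> sphere 0 1" by simp
  ultimately obtain v where v: "norm v = 1" "\<And>u. norm u = 1 \<Longrightarrow> u \<bullet> (A *v u) \<le> v \<bullet> (A *v v)"
    using continuous_attains_sup[of "sphere 0 1" "\<lambda>u. u \<bullet> (A *v u)"]
    by (metis compact_sphere dist_0_norm empty_iff mem_sphere)
  define l where "l = v \<bullet> (A *v v)"
  have le: "u \<bullet> (A *v u) \<le> l * (u \<bullet> u)" for u
  proof (cases "u = 0")
    case False
    have "(u /\<^sub>R norm u) \<bullet> (A *v (u /\<^sub>R norm u)) \<le> l"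
      unfolding l_def using False by (intro v(2)) simp
    also have "(u /\<^sub>R norm u) \<bullet> (A *v (u /\<^sub>R norm u)) = (u \<bullet> (A *v u)) / (norm u)\<^sup>2"
      by (simp add: matrix_vector_mult_scaleR power2_eq_square field_simps)
    finally show ?thesis using False by (simp add: divide_le_eq power2_norm_eq_inner)
  qed simp
  define B where "B u = l *\<^sub>R u - A *v u" for u
  have Bsym: "x \<bullet> B y = B x \<bullet> y" for x y
    using dot_lmul_matrix[of x A y] sym unfolding B_def
    by (simp add: inner_diff_left inner_diff_right) (metis vector_transpose_matrix)
  have Bpos: "0 \<le> u \<bullet> B u" for u using le[of u] by (simp add: B_def inner_diff_right)
  have Bv: "v \<bullet> B v = 0"
    using v(1) by (simp add: B_def inner_diff_right l_def flip: power2_norm_eq_inner)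
  define x where "x = B v"
  define r where "r = x \<bullet> B x"
  define p where "p = x \<bullet> x"
  have "r \<ge> 0" using Bpos by (simp add: r_def)
  \<comment> \<open>A positive semidefinite form vanishes at \<open>v\<close> only if \<open>v\<close> is in its kernel: otherwise moving
    slightly from \<open>v\<close> against \<open>B v\<close> would make the form negative.\<close>
  have quad: "0 \<le> 2 * t * p + t\<^sup>2 * r" for t
  proof -
    have "B (v + t *\<^sub>R x) = B v + t *\<^sub>R B x"
      by (simp add: B_def matrix_vector_right_distrib matrix_vector_mult_scaleR algebra_simps)
    then have "(v + t *\<^sub>R x) \<bullet> B (v + t *\<^sub>R x) = v \<bullet> B v + t * (v \<bullet> B x) + t * (x \<bullet> B v) + t\<^sup>2 * (x \<bullet> B x)"
      by (simp add: inner_add_left inner_add_right algebra_simps power2_eq_square)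
    also have "\<dots> = 2 * t * p + t\<^sup>2 * r"
      using Bsym[of v x] Bv by (simp add: p_def r_def x_def)
    finally show ?thesis using Bpos[of "v + t *\<^sub>R x"] by simp
  qed
  define t where "t = - p / (r + 1)"
  have t: "t * (r + 1) = - p" using \<open>r \<ge> 0\<close> by (simp add: t_def)
  have "0 \<le> (2 * t * p + t\<^sup>2 * r) * (r + 1)\<^sup>2" using quad by simp
  also have "\<dots> = 2 * (t * (r + 1)) * p * (r + 1) + (t * (r + 1))\<^sup>2 * r"
    by (simp add: power2_eq_square algebra_simps)
  also have "\<dots> = - (p\<^sup>2 * (r + 2))"
    unfolding t by (simp add: power2_eq_square algebra_simps)
  finally have "p\<^sup>2 * (r + 2) \<le> 0" by simp
  then have "p = 0" using \<open>r \<ge> 0\<close> by (simp add: mult_le_0_iff)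
  then have "A *v v = l *\<^sub>R v" by (simp add: p_def x_def B_def)
  moreover have "v \<noteq> 0" using v(1) by auto
  ultimately show ?thesis using le that by blast
qed

lemma lambda_max_less_iff:
  fixes A :: "real ^ 'n::finite ^ 'n"
  assumes sym: "transpose A = A"
  shows "lambda_max A < c \<longleftrightarrow> (\<forall>v. v \<noteq> 0 \<longrightarrow> v \<bullet> (A *v v) < c * (v \<bullet> v))"
proof -
  obtain v l where v: "v \<noteq> 0" "A *v v = l *\<^sub>R v" and le: "\<And>u. u \<bullet> (A *v u) \<le> l * (u \<bullet> u)"
    using Rayleigh_maximizer[OF sym] by metis
  have "lambda_max A = l"
    unfolding lambda_max_def
  proof (rule Max_eqI)
    fix k assume "k \<in> {l. \<exists>v. v \<noteq> 0 \<and> A *v v = l *\<^sub>R v}"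
    then obtain u where "u \<noteq> 0" "A *v u = k *\<^sub>R u" by blast
    then show "k \<le> l" using le[of u] by simp
  qed (use v finite_eigenvalues_symmetric[OF sym] in auto)
  moreover have "l < c \<longleftrightarrow> (\<forall>v. v \<noteq> 0 \<longrightarrow> v \<bullet> (A *v v) < c * (v \<bullet> v))"
  proof (intro iffI allI impI)
    fix u :: "real ^ 'n" assume "l < c" "u \<noteq> 0"
    then have "l * (u \<bullet> u) < c * (u \<bullet> u)" by simp
    then show "u \<bullet> (A *v u) < c * (u \<bullet> u)" using le[of u] by linarith
  next
    assume "\<forall>v. v \<noteq> 0 \<longrightarrow> v \<bullet> (A *v v) < c * (v \<bullet> v)"
    then show "l < c" using v by force
  qed
  ultimately show ?thesis by simp
qed

section \<open>Convexity of the relaxation set\<close>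

text \<open>
  Read \<open>z\<close> as a mixture of the two fluids with volume fractions \<open>\<theta> = (\<mu> - \<rho>m) / (\<rho>p - \<rho>m)\<close> and
  \<open>1 - \<theta>\<close> and velocities \<open>w_+ = (m - \<rho>m w) / (\<mu> - \<rho>m)\<close> and \<open>w_- = (m - \<rho>p w) / (\<mu> - \<rho>p)\<close>, so that
  \<open>w = \<theta> w_+ + (1 - \<theta>) w_-\<close> and \<open>m = \<theta> \<rho>p w_+ + (1 - \<theta>) \<rho>m w_-\<close>. The quantity below is
  \<open>\<rho>p - \<rho>m\<close> times the momentum flux \<open>\<theta> \<rho>p (v \<bullet> w_+)\<^sup>2 + (1 - \<theta>) \<rho>m (v \<bullet> w_-)\<^sup>2\<close> of the mixture
  in direction \<open>v\<close>.
\<close>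

definition phase_momentum_flux ::
  "real \<Rightarrow> real \<Rightarrow> real ^ 'n \<Rightarrow> real \<Rightarrow> real ^ 'n \<Rightarrow> real ^ 'n \<Rightarrow> real" where
  "phase_momentum_flux \<rho>m \<rho>p v \<mu> w m =
     \<rho>p * (v \<bullet> (m - \<rho>m *\<^sub>R w))\<^sup>2 / (\<mu> - \<rho>m) + \<rho>m * (v \<bullet> (m - \<rho>p *\<^sub>R w))\<^sup>2 / (\<rho>p - \<mu>)"

lemma outer_mult_vector: "outer a b *v v = (b \<bullet> v) *\<^sub>R a"
  by (simp add: vec_eq_iff outer_def matrix_vector_mult_def inner_vec_def sum_distrib_right
      sum_distrib_left mult_ac)

lemma inner_outer_mult: "v \<bullet> (outer a b *v v) = (v \<bullet> a) * (v \<bullet> b)"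
  by (simp add: outer_mult_vector inner_commute[of b])

lemma matrix_vector_mult_scaleR_left: "(c *\<^sub>R A) *v v = c *\<^sub>R (A *v v)" for A :: "real ^ 'n ^ 'm"
  by (simp add: scaleR_matrix_vector_assoc)

text \<open>
  The rational expression in \<open>M_tilde\<close> is thus a sum of two squares of linear functions divided by
  positive affine ones, which is the form in which its convexity is visible.
\<close>

lemma inner_M_tilde:
  fixes v :: "real ^ 'n::finite"
  assumes "\<rho>m < \<mu>" "\<mu> < \<rho>p"
  shows "(\<rho>p - \<rho>m) * (v \<bullet> (M_tilde \<rho>m \<rho>p (\<mu>, w, m, h, \<sigma>, e) *v v)) =
    phase_momentum_flux \<rho>m \<rho>p v \<mu> w m - (\<rho>p - \<rho>m) * (v \<bullet> (\<sigma> *v v))"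
proof -
  define a where "a = v \<bullet> m"
  define b where "b = v \<bullet> w"
  have scalar: "(\<rho>p - \<rho>m) * ((\<mu> * \<rho>m * \<rho>p * b\<^sup>2 - 2 * \<rho>m * \<rho>p * a * b + (\<rho>p + \<rho>m - \<mu>) * a\<^sup>2)
      / ((\<rho>p - \<mu>) * (\<mu> - \<rho>m)))
    = \<rho>p * (a - \<rho>m * b)\<^sup>2 / (\<mu> - \<rho>m) + \<rho>m * (a - \<rho>p * b)\<^sup>2 / (\<rho>p - \<mu>)"
    using assms by (simp add: divide_simps) (simp add: power2_eq_square algebra_simps)
  define X where "X =
     (\<mu> * \<rho>m * \<rho>p * b\<^sup>2 - 2 * \<rho>m * \<rho>p * a * b + (\<rho>p + \<rho>m - \<mu>) * a\<^sup>2)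
      / ((\<rho>p - \<mu>) * (\<mu> - \<rho>m))"
  have "v \<bullet> (M_tilde \<rho>m \<rho>p (\<mu>, w, m, h, \<sigma>, e) *v v) = X - v \<bullet> (\<sigma> *v v)"
    unfolding M_tilde_def X_def
    by (simp add: matrix_vector_mult_diff_rdistrib matrix_vector_mult_add_rdistrib
        matrix_vector_mult_scaleR_left inner_diff_right inner_add_right inner_outer_mult
        a_def[symmetric] b_def[symmetric] power2_eq_square mult_ac)
  then have "(\<rho>p - \<rho>m) * (v \<bullet> (M_tilde \<rho>m \<rho>p (\<mu>, w, m, h, \<sigma>, e) *v v)) =
      (\<rho>p - \<rho>m) * X - (\<rho>p - \<rho>m) * (v \<bullet> (\<sigma> *v v))"
    by (simp only: right_diff_distrib)
  also have "(\<rho>p - \<rho>m) * X = phase_momentum_flux \<rho>m \<rho>p v \<mu> w m"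
    unfolding X_def scalar phase_momentum_flux_def
    by (simp add: inner_diff_right a_def b_def)
  finally show ?thesis .
qed

lemma transpose_M_tilde:
  assumes "transpose \<sigma> = \<sigma>"
  shows "transpose (M_tilde \<rho>m \<rho>p (\<mu>, w, m, h, \<sigma>, e)) = M_tilde \<rho>m \<rho>p (\<mu>, w, m, h, \<sigma>, e)"
proof -
  have "\<sigma> $ j $ i = \<sigma> $ i $ j" for i j
    using arg_cong[OF assms, of "\<lambda>A. A $ i $ j"] by (simp add: transpose_def)
  then show ?thesis
    by (simp add: M_tilde_def transpose_def outer_def vec_eq_iff mult_ac add.commute)
qed

lemma relaxation_set_iff:
  fixes z :: "'n::finite state"
  assumes "\<rho>m < \<rho>p" and z: "z = (\<mu>, w, m, h, \<sigma>, e)"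
  shows "z \<in> relaxation_set \<rho>m \<rho>p \<longleftrightarrow>
    transpose \<sigma> = \<sigma> \<and> trace \<sigma> = 0 \<and> \<rho>m < \<mu> \<and> \<mu> < \<rho>p \<and>
    (\<forall>v. v \<noteq> 0 \<longrightarrow> phase_momentum_flux \<rho>m \<rho>p v \<mu> w m
        < (\<rho>p - \<rho>m) * (v \<bullet> (\<sigma> *v v) + 2 / real CARD('n) * e * (v \<bullet> v)))"
proof -
  have "lambda_max (M_tilde \<rho>m \<rho>p z) < 2 / real CARD('n) * e \<longleftrightarrow>
     (\<forall>v. v \<noteq> 0 \<longrightarrow> phase_momentum_flux \<rho>m \<rho>p v \<mu> w m
        < (\<rho>p - \<rho>m) * (v \<bullet> (\<sigma> *v v) + 2 / real CARD('n) * e * (v \<bullet> v)))"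
    if "transpose \<sigma> = \<sigma>" "\<rho>m < \<mu>" "\<mu> < \<rho>p"
  proof -
    have "(v \<bullet> (M_tilde \<rho>m \<rho>p z *v v) < c) \<longleftrightarrow>
       phase_momentum_flux \<rho>m \<rho>p v \<mu> w m < (\<rho>p - \<rho>m) * (v \<bullet> (\<sigma> *v v) + c)" for v c
    proof -
      have "(v \<bullet> (M_tilde \<rho>m \<rho>p z *v v) < c) \<longleftrightarrow>
         (\<rho>p - \<rho>m) * (v \<bullet> (M_tilde \<rho>m \<rho>p z *v v)) < (\<rho>p - \<rho>m) * c"
        using assms by simp
      then show ?thesis
        unfolding z inner_M_tilde[OF that(2,3)] by (simp add: distrib_left less_diff_eq algebra_simps)
    qed
    then show ?thesis
      using transpose_M_tilde[OF that(1)] unfolding z by (simp add: lambda_max_less_iff)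
  qed
  then show ?thesis
    by (auto simp: relaxation_set_def Z_space_def sym_traceless_def z)
qed

text \<open>
  Multiplied by \<open>s a + t b\<close>, the difference of the two sides is the nonnegative quantity
  \<open>s t (b x - a y)\<^sup>2 / (a b)\<close>.
\<close>

lemma square_over_linear_convex:
  fixes a b s t x y :: real
  assumes "0 < a" "0 < b" "0 \<le> s" "0 \<le> t" "s + t = 1"
  shows "(s * x + t * y)\<^sup>2 / (s * a + t * b) \<le> s * (x\<^sup>2 / a) + t * (y\<^sup>2 / b)"
proof -
  have pos: "0 < s * a + t * b"
    using assms by (metis add_0 add_nonneg_pos add_pos_nonneg less_eq_real_def mult_nonneg_nonneg mult_pos_pos zero_less_one)
  have "(s * (x\<^sup>2 / a) + t * (y\<^sup>2 / b)) * (s * a + t * b) - (s * x + t * y)\<^sup>2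
      = s * t * (b * x - a * y)\<^sup>2 / (a * b)"
    using assms(1,2) by (simp add: field_simps power2_eq_square)
  moreover have "0 \<le> s * t * (b * x - a * y)\<^sup>2 / (a * b)" using assms by simp
  ultimately show ?thesis using pos by (simp add: divide_le_eq)
qed

lemma phase_momentum_flux_convex:
  fixes v :: "real ^ 'n::finite"
  assumes "0 < \<rho>m" "\<rho>m < \<rho>p" "\<rho>m < \<mu>" "\<mu> < \<rho>p" "\<rho>m < \<mu>'" "\<mu>' < \<rho>p" 
    and st: "0 \<le> s" "0 \<le> t" "s + t = 1"
  shows "phase_momentum_flux \<rho>m \<rho>p v (s * \<mu> + t * \<mu>') (s *\<^sub>R w + t *\<^sub>R w') (s *\<^sub>R m + t *\<^sub>R m')
    \<le> s * phase_momentum_flux \<rho>m \<rho>p v \<mu> w m + t * phase_momentum_flux \<rho>m \<rho>p v \<mu>' w' m'"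
proof -
  have t: "t = 1 - s" using st by simp
  have lin: "v \<bullet> ((s *\<^sub>R m + t *\<^sub>R m') - \<rho> *\<^sub>R (s *\<^sub>R w + t *\<^sub>R w'))
      = s * (v \<bullet> (m - \<rho> *\<^sub>R w)) + t * (v \<bullet> (m' - \<rho> *\<^sub>R w'))" for \<rho>
    by (simp add: inner_diff_right inner_add_right algebra_simps)
  have den: "s * \<mu> + t * \<mu>' - \<rho>m = s * (\<mu> - \<rho>m) + t * (\<mu>' - \<rho>m)"
    "\<rho>p - (s * \<mu> + t * \<mu>') = s * (\<rho>p - \<mu>) + t * (\<rho>p - \<mu>')"
    unfolding t by (simp_all add: algebra_simps)
  have pos: "0 \<le> \<rho>m" "0 \<le> \<rho>p" using assms by auto
  note 1 = mult_left_mono[OF square_over_linear_convex[of "\<mu> - \<rho>m" "\<mu>' - \<rho>m" s t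
      "v \<bullet> (m - \<rho>m *\<^sub>R w)" "v \<bullet> (m' - \<rho>m *\<^sub>R w')"] pos(2)]
  note 2 = mult_left_mono[OF square_over_linear_convex[of "\<rho>p - \<mu>" "\<rho>p - \<mu>'" s t
      "v \<bullet> (m - \<rho>p *\<^sub>R w)" "v \<bullet> (m' - \<rho>p *\<^sub>R w')"] pos(1)]
  show ?thesis
    unfolding phase_momentum_flux_def lin den
    using add_mono[OF 1 2] assms by (simp add: algebra_simps)
qed

lemma convex_relaxation_set:
  assumes \<rho>: "0 < \<rho>m" "\<rho>m < \<rho>p"
  shows "convex (relaxation_set \<rho>m \<rho>p :: 'n::finite state set)"
proof (rule convexI)
  fix x y :: "'n state" and s t :: real
  assume x: "x \<in> relaxation_set \<rho>m \<rho>p" and y: "y \<in> relaxation_set \<rho>m \<rho>p"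
    and st: "0 \<le> s" "0 \<le> t" "s + t = 1"
  obtain \<mu> w m h \<sigma> e where xe: "x = (\<mu>, w, m, h, \<sigma>, e)" by (metis prod_cases6)
  obtain \<mu>' w' m' h' \<sigma>' e' where ye: "y = (\<mu>', w', m', h', \<sigma>', e')" by (metis prod_cases6)
  note x = x[unfolded relaxation_set_iff[OF \<rho>(2) xe]]
  note y = y[unfolded relaxation_set_iff[OF \<rho>(2) ye]]
  have "s *\<^sub>R x + t *\<^sub>R y = (s * \<mu> + t * \<mu>', s *\<^sub>R w + t *\<^sub>R w', s *\<^sub>R m + t *\<^sub>R m',
      s *\<^sub>R h + t *\<^sub>R h', s *\<^sub>R \<sigma> + t *\<^sub>R \<sigma>', s * e + t * e')"
    by (simp add: xe ye)
  moreover have comb: "s * a + t * a' < s * b + t * b'" if "a < b" "a' < b'" for a a' b b' :: real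
  proof (cases "s = 0")
    case False
    then have "s * a < s * b" "t * a' \<le> t * b'" using st that by (auto intro: mult_left_mono)
    then show ?thesis by linarith
  qed (use st that in auto)
  have "\<rho>m < s * \<mu> + t * \<mu>'" "s * \<mu> + t * \<mu>' < \<rho>p"
    using comb[of \<rho>m \<mu> \<rho>m \<mu>'] comb[of \<mu> \<rho>p \<mu>' \<rho>p] x y st(3)
    by (simp_all flip: distrib_right)
  moreover have "transpose (s *\<^sub>R \<sigma> + t *\<^sub>R \<sigma>') = s *\<^sub>R \<sigma> + t *\<^sub>R \<sigma>'"
    using x y by (simp add: transpose_def vec_eq_iff)
  moreover have "trace (s *\<^sub>R \<sigma> + t *\<^sub>R \<sigma>') = 0"
    using x y by (simp add: trace_def sum.distrib flip: sum_distrib_left)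
  moreover have "phase_momentum_flux \<rho>m \<rho>p v (s * \<mu> + t * \<mu>') (s *\<^sub>R w + t *\<^sub>R w') (s *\<^sub>R m + t *\<^sub>R m')
      < (\<rho>p - \<rho>m) * (v \<bullet> ((s *\<^sub>R \<sigma> + t *\<^sub>R \<sigma>') *v v) + 2 / real CARD('n) * (s * e + t * e') * (v \<bullet> v))"
    if "v \<noteq> 0" for v :: "real ^ 'n"
  proof -
    let ?c = "2 / real CARD('n)"
    have "phase_momentum_flux \<rho>m \<rho>p v (s * \<mu> + t * \<mu>') (s *\<^sub>R w + t *\<^sub>R w') (s *\<^sub>R m + t *\<^sub>R m')
      \<le> s * phase_momentum_flux \<rho>m \<rho>p v \<mu> w m + t * phase_momentum_flux \<rho>m \<rho>p v \<mu>' w' m'"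
      using x y \<rho> st by (intro phase_momentum_flux_convex) auto
    also have "\<dots> < s * ((\<rho>p - \<rho>m) * (v \<bullet> (\<sigma> *v v) + ?c * e * (v \<bullet> v)))
       + t * ((\<rho>p - \<rho>m) * (v \<bullet> (\<sigma>' *v v) + ?c * e' * (v \<bullet> v)))"
      using x y that by (intro comb) auto
    also have "\<dots> = (\<rho>p - \<rho>m) * (v \<bullet> ((s *\<^sub>R \<sigma> + t *\<^sub>R \<sigma>') *v v) + ?c * (s * e + t * e') * (v \<bullet> v))"
      by (simp add: matrix_vector_mult_add_rdistrib matrix_vector_mult_scaleR_left inner_add_right
          distrib_left distrib_right mult_ac add_divide_distrib)
    finally show ?thesis .
  qed
  ultimately show "s *\<^sub>R x + t *\<^sub>R y \<in> relaxation_set \<rho>m \<rho>p"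
    by (subst relaxation_set_iff[OF \<rho>(2)]) auto
qed

lemma phase_momentum_flux_common_velocity:
  fixes v :: "real ^ 'n::finite"
  assumes "\<rho>m < \<mu>" "\<mu> < \<rho>p"
  shows "phase_momentum_flux \<rho>m \<rho>p v \<mu> w (\<mu> *\<^sub>R w) = (\<rho>p - \<rho>m) * (\<mu> * (v \<bullet> w)\<^sup>2)"
  using assms unfolding phase_momentum_flux_def
  by (simp add: inner_diff_right divide_simps) (simp add: power2_eq_square algebra_simps)

text \<open>
  An Euler state is moved inside the relaxation set by mixing in a little of the other fluid at the
  same velocity and raising the energy to compensate: in a mixture with common velocity \<open>w\<close> the flux
  is \<open>\<mu> (v \<bullet> w)\<^sup>2\<close>, so a change of density by \<open>t \<delta>\<close> changes it by at most \<open>t |\<delta>| |w|\<^sup>2 |v|\<^sup>2\<close>.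
\<close>

lemma euler_state_in_closure_relaxation_set:
  fixes w h :: "real ^ 'n::finite"
  assumes \<rho>: "0 < \<rho>m" "\<rho>m < \<rho>p" and \<mu>: "\<mu> \<in> {\<rho>m, \<rho>p}"
    and tr: "trace \<sigma> = 0"
    and \<sigma>: "\<mu> *\<^sub>R outer w w = \<sigma> + (2 / real CARD('n) * e) *\<^sub>R mat 1"
  shows "(\<mu>, w, \<mu> *\<^sub>R w, h, \<sigma>, e) \<in> closure (relaxation_set \<rho>m \<rho>p)"
proof -
  define n where "n = real CARD('n)"
  have n: "0 < n" by (simp add: n_def)
  define \<delta> where "\<delta> = (\<rho>m + \<rho>p) / 2 - \<mu>"
  \<comment> \<open>The summand \<open>1\<close> makes the inequality strict even when \<open>w = 0\<close>.\<close>
  define \<epsilon> where "\<epsilon> = (\<rho>p - \<rho>m) * (w \<bullet> w) + 1"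
  define d where "d = (\<delta>, 0 :: real ^ 'n, \<delta> *\<^sub>R w, 0 :: real ^ 'n, 0 :: real ^ 'n ^ 'n, n / 2 * \<epsilon>)"
  define z where "z = (\<mu>, w, \<mu> *\<^sub>R w, h, \<sigma>, e)"
  have \<sigma>_eq: "\<sigma> = \<mu> *\<^sub>R outer w w - (2 / n * e) *\<^sub>R mat 1" using \<sigma> by (simp add: n_def)
  have sym: "transpose \<sigma> = \<sigma>"
    unfolding \<sigma>_eq by (simp add: transpose_def vec_eq_iff outer_def mat_def mult.commute)
  have "z + t *\<^sub>R d \<in> relaxation_set \<rho>m \<rho>p" if t: "0 < t" "t < 1" for t
  proof -
    have ztd: "z + t *\<^sub>R d = (\<mu> + t * \<delta>, w, (\<mu> + t * \<delta>) *\<^sub>R w, h, \<sigma>, e + t * (n / 2 * \<epsilon>))"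
      by (simp add: z_def d_def scaleR_add_left)
    have "\<rho>m < \<mu> + t * \<delta> \<and> \<mu> + t * \<delta> < \<rho>p"
    proof -
      have "0 < t * ((\<rho>p - \<rho>m) / 2)" "t * ((\<rho>p - \<rho>m) / 2) < 1 * ((\<rho>p - \<rho>m) / 2)"
        using t \<rho> by (auto intro!: mult_strict_right_mono)
      then show ?thesis using \<mu> by (auto simp: \<delta>_def field_simps)
    qed
    moreover have "(\<rho>p - \<rho>m) * ((\<mu> + t * \<delta>) * (v \<bullet> w)\<^sup>2)
       < (\<rho>p - \<rho>m) * (v \<bullet> (\<sigma> *v v) + 2 / n * (e + t * (n / 2 * \<epsilon>)) * (v \<bullet> v))"
      if v: "v \<noteq> 0" for v :: "real ^ 'n"
    proof -
      have "v \<bullet> (\<sigma> *v v) = \<mu> * (v \<bullet> w)\<^sup>2 - 2 / n * e * (v \<bullet> v)"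
        unfolding \<sigma>_eq
        by (simp add: matrix_vector_mult_diff_rdistrib matrix_vector_mult_scaleR_left
            inner_diff_right inner_outer_mult power2_eq_square)
      moreover have "\<delta> * (v \<bullet> w)\<^sup>2 < \<epsilon> * (v \<bullet> v)"
      proof -
        have "\<delta> * (v \<bullet> w)\<^sup>2 \<le> (\<rho>p - \<rho>m) * ((v \<bullet> v) * (w \<bullet> w))"
          using \<mu> \<rho> Cauchy_Schwarz_ineq[of v w] by (intro mult_mono) (auto simp: \<delta>_def field_simps)
        also have "\<dots> < \<epsilon> * (v \<bullet> v)" using v by (simp add: \<epsilon>_def algebra_simps)
        finally show ?thesis .
      qed
      then have "t * (\<delta> * (v \<bullet> w)\<^sup>2) < t * (\<epsilon> * (v \<bullet> v))" using t by simp
      moreover have "2 / n * (e + t * (n / 2 * \<epsilon>)) * (v \<bullet> v) = 2 / n * e * (v \<bullet> v) + t * (\<epsilon> * (v \<bullet> v))"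
        using n by (simp add: field_simps)
      ultimately have "(\<mu> + t * \<delta>) * (v \<bullet> w)\<^sup>2
          < v \<bullet> (\<sigma> *v v) + 2 / n * (e + t * (n / 2 * \<epsilon>)) * (v \<bullet> v)"
        by (simp add: distrib_right)
      then show ?thesis using \<rho> by simp
    qed
    ultimately show ?thesis
      using \<rho> sym tr
      by (subst relaxation_set_iff[OF \<rho>(2) ztd]) (auto simp: phase_momentum_flux_common_velocity n_def)
  qed
  then have "z + inverse (real (Suc (Suc k))) *\<^sub>R d \<in> relaxation_set \<rho>m \<rho>p" for k
    by (auto simp: divide_simps)
  moreover have "(\<lambda>k. z + inverse (real (Suc (Suc k))) *\<^sub>R d) \<longlonglongrightarrow> z + 0 *\<^sub>R d"
    by (intro tendsto_intros LIMSEQ_Suc[OF LIMSEQ_inverse_real_of_nat])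
  ultimately have "\<exists>f. (\<forall>k. f k \<in> relaxation_set \<rho>m \<rho>p) \<and> f \<longlonglongrightarrow> z"
    by (intro exI[of _ "\<lambda>k. z + inverse (real (Suc (Suc k))) *\<^sub>R d"]) simp
  then show ?thesis unfolding closure_sequential z_def .
qed

section \<open>The space-time domain as a measure space\<close>

lemma open_spacetime_covering: "admissible_container C \<Longrightarrow> open (spacetime_covering N g T C)"
proof -
  assume C: "admissible_container C"
  have cov: "open (covering N C)"
  proof (cases C)
    case (Torus_Strip a L)
    have "open {y :: real ^ 'a. - L < y $ N}" "open {y :: real ^ 'a. y $ N < L}"
      by (intro open_Collect_less continuous_intros)+
    then have "open ({y. - L < y $ N} \<inter> {y. y $ N < L})" by (rule open_Int)
    then show ?thesis by (simp add: Torus_Strip Collect_conj_eq)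
  qed (use C in auto)
  have eq: "spacetime_covering N g T C = {p. 0 < snd p} \<inter> {p. snd p < T} \<inter>
      (\<lambda>p. fst p - (1/2 * g * (snd p)\<^sup>2) *\<^sub>R axis N 1) -` covering N C"
    by (auto simp: spacetime_covering_def)
  show ?thesis
    unfolding eq
    by (intro open_Int open_Collect_less open_vimage[OF cov] continuous_intros)
qed

lemma spacetime_in_lebesgue:
  fixes N :: "'n::finite"
  assumes "admissible_container C"
  shows "spacetime N g T C \<in> sets lebesgue"
proof -
  have "fundamental_cell N C \<in> sets borel"
  proof (cases C)
    case (Torus_Strip a L)
    have "fundamental_cell N C = (\<Inter>i. {y. i \<noteq> N \<longrightarrow> 0 \<le> y $ i} \<inter> {y. i \<noteq> N \<longrightarrow> y $ i < a})"
      by (auto simp: Torus_Strip)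
    moreover have "{y :: real ^ 'n. i \<noteq> N \<longrightarrow> 0 \<le> y $ i} \<inter> {y. i \<noteq> N \<longrightarrow> y $ i < a} \<in> sets borel" for i
    proof (cases "i = N")
      case False
      have "{y :: real ^ 'n. 0 \<le> y $ i} \<in> sets borel" "{y :: real ^ 'n. y $ i < a} \<in> sets borel"
        by (intro borel_closed closed_Collect_le borel_open open_Collect_less continuous_intros)+
      with False show ?thesis by simp
    qed simp
    ultimately show ?thesis by (simp only: sets.finite_INT finite UNIV_not_empty not_False_eq_True)
  qed simp
  then have "fundamental_cell N C \<times> (UNIV :: real set) \<in> sets (borel \<Otimes>\<^sub>M borel)" by simp
  then have "fundamental_cell N C \<times> (UNIV :: real set) \<in> sets borel" by (simp only: borel_prod)
  moreover have "spacetime_covering N g T C \<in> sets borel"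
    using open_spacetime_covering[OF assms] by (rule borel_open)
  ultimately have "spacetime N g T C \<in> sets borel" unfolding spacetime_def by (rule sets.Int[rotated])
  then show ?thesis by (simp add: sets_completionI_sets)
qed

lemma sigma_finite_lebesgue_on:
  fixes D :: "'a::euclidean_space set"
  assumes D: "D \<in> sets lebesgue"
  shows "sigma_finite_measure (lebesgue_on D)"
proof
  show "\<exists>A. countable A \<and> A \<subseteq> sets (lebesgue_on D) \<and> \<Union> A = space (lebesgue_on D) \<and>
      (\<forall>a\<in>A. emeasure (lebesgue_on D) a \<noteq> \<infinity>)"
  proof (intro exI[of _ "range (\<lambda>k::nat. D \<inter> cball 0 (real k))"] conjI ballI)
    show "range (\<lambda>k::nat. D \<inter> cball 0 (real k)) \<subseteq> sets (lebesgue_on D)"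
      using D by (auto simp: sets_restrict_space_iff intro!: sets.Int[OF D])
    have "x \<in> (\<Union>k. D \<inter> cball 0 (real k))" if "x \<in> D" for x
      using that real_arch_simple[of "norm x"] by auto
    then show "\<Union> (range (\<lambda>k::nat. D \<inter> cball 0 (real k))) = space (lebesgue_on D)" by auto
    fix a assume "a \<in> range (\<lambda>k::nat. D \<inter> cball 0 (real k))"
    then obtain k :: nat where a: "a = D \<inter> cball 0 (real k)" by blast
    have "emeasure (lebesgue_on D) a = emeasure lebesgue a"
      using D by (simp add: a emeasure_restrict_space)
    also have "\<dots> \<le> emeasure lebesgue (cball 0 (real k) :: 'a set)"
      unfolding a using D by (intro emeasure_mono) auto
    also have "\<dots> < \<infinity>"
      using emeasure_lborel_cball_finite[of "0 :: 'a" "real k"] by simp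
    finally show "emeasure (lebesgue_on D) a \<noteq> \<infinity>" by simp
  qed simp
qed

lemma continuous_borel_measurable_lebesgue_on:
  fixes f :: "'a::euclidean_space \<Rightarrow> 'b::real_normed_vector"
  assumes "continuous_on UNIV f"
  shows "f \<in> borel_measurable (lebesgue_on D)"
  using borel_measurable_continuous_onI[OF assms]
  by (intro measurable_restrict_space1 measurable_completion) simp

section \<open>Derivatives of test functions\<close>

lemma continuous_derivative_test_function:
  "test_function N g T C \<phi> \<Longrightarrow> continuous_on UNIV (\<lambda>p. frechet_derivative \<phi> (at p) v)"
  by (metis Ck.simps test_function_def)

text \<open>
  The support of a test function is compact only modulo the periods. By periodicity the bound on the
  compact set \<open>K\<close> holds wherever \<open>\<phi> \<noteq> 0\<close>, by continuity on the closure of this set, and off the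
  closure the derivative vanishes.
\<close>

lemma bounded_derivative_test_function:
  fixes \<phi> :: "'n::finite point \<Rightarrow> real"
  assumes \<phi>: "test_function N g T C \<phi>"
  obtains B where "\<And>p. \<bar>frechet_derivative \<phi> (at p) v\<bar> \<le> B"
proof -
  let ?g = "\<lambda>p. frechet_derivative \<phi> (at p) v"
  have cont: "continuous_on UNIV ?g" by (rule continuous_derivative_test_function[OF \<phi>])
  have diff: "\<phi> differentiable at p" for p
    using \<phi> by (metis Ck.simps(2) test_function_def)
  have per: "\<phi> (y + l, t) = \<phi> (y, t)" if "l \<in> periods N C" for l y t
    using \<phi> that by (simp add: test_function_def compactly_supported_def)
  obtain K where K: "compact K" "\<And>y t. \<phi> (y, t) \<noteq> 0 \<Longrightarrow> \<exists>l\<in>periods N C. (y + l, t) \<in> K"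
    using \<phi> by (auto simp: test_function_def compactly_supported_def)
  have "bounded (?g ` K)"
    using K(1) cont by (intro compact_imp_bounded compact_continuous_image) (auto intro: continuous_on_subset)
  then obtain B where B: "0 < B" "\<And>p. p \<in> K \<Longrightarrow> \<bar>?g p\<bar> \<le> B"
    unfolding bounded_pos by auto
  have supp: "\<bar>?g p\<bar> \<le> B" if nz: "\<phi> p \<noteq> 0" for p
  proof -
    obtain y t where p: "p = (y, t)" by (cases p)
    obtain l where l: "l \<in> periods N C" "p + (l, 0) \<in> K" using K(2)[of y t] nz unfolding p by auto
    have "((\<lambda>x. \<phi> (x + (l, 0))) has_derivative frechet_derivative \<phi> (at (p + (l, 0)))) (at p)"
    proof -
      have "((\<lambda>x. x + (l, 0)) has_derivative (\<lambda>x. x)) (at p)"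
        by (auto intro!: derivative_eq_intros)
      from has_derivative_compose[OF this diff[unfolded frechet_derivative_works]]
      show ?thesis by simp
    qed
    moreover have "(\<lambda>x. \<phi> (x + (l, 0))) = \<phi>" using per[OF l(1)] by (auto simp: fun_eq_iff)
    ultimately have "frechet_derivative \<phi> (at (p + (l, 0))) = frechet_derivative \<phi> (at p)"
      using frechet_derivative_at by simp
    then show ?thesis using B(2)[OF l(2)] by simp
  qed
  have "\<bar>?g p\<bar> \<le> B" for p
  proof (cases "p \<in> closure {p. \<phi> p \<noteq> 0}")
    case True
    have "closed {p. \<bar>?g p\<bar> \<le> B}"
      by (intro closed_Collect_le continuous_on_rabs cont continuous_on_const)
    then have "closure {p. \<phi> p \<noteq> 0} \<subseteq> {p. \<bar>?g p\<bar> \<le> B}"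
      using supp by (intro closure_minimal) auto
    then show ?thesis using True by blast
  next
    case False
    have "(\<phi> has_derivative (\<lambda>_. 0)) (at p)"
    proof (rule has_derivative_transform_within_open[where f="\<lambda>_. 0"])
      show "open (- closure {p. \<phi> p \<noteq> 0})" by (simp add: open_Compl)
      show "0 = \<phi> x" if "x \<in> - closure {p. \<phi> p \<noteq> 0}" for x
        using that closure_subset[of "{p. \<phi> p \<noteq> 0}"] by auto
    qed (use False in auto)
    then have "(\<lambda>_. 0) = frechet_derivative \<phi> (at p)" by (rule frechet_derivative_at)
    then show ?thesis using B(1) by (metis abs_zero less_imp_le)
  qed
  then show ?thesis using that by blast
qed

lemma in_Linf_time_deriv:
  assumes "test_function N g T C \<phi>"
  shows "in_Linf (lebesgue_on D) (time_deriv \<phi>)"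
proof -
  obtain B where "\<And>p. \<bar>frechet_derivative \<phi> (at p) (0, 1)\<bar> \<le> B"
    using bounded_derivative_test_function[OF assms] by metis
  moreover have "time_deriv \<phi> \<in> borel_measurable (lebesgue_on D)"
    using continuous_derivative_test_function[OF assms, of "(0, 1)"]
    by (intro continuous_borel_measurable_lebesgue_on) (simp add: time_deriv_def[abs_def])
  ultimately show ?thesis by (intro in_Linf_I[where B=B]) (auto simp: time_deriv_def)
qed

lemma in_Linf_space_grad:
  fixes \<phi> :: "'n::finite point \<Rightarrow> real"
  assumes "test_function N g T C \<phi>"
  shows "in_Linf (lebesgue_on D) (space_grad \<phi>)"
proof -
  have "\<exists>B. \<forall>p. \<bar>frechet_derivative \<phi> (at p) (axis i 1, 0)\<bar> \<le> B" for i
    using bounded_derivative_test_function[OF assms] by metis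
  then obtain B where B: "\<And>i p. \<bar>frechet_derivative \<phi> (at p) (axis i 1, 0)\<bar> \<le> B i" by metis
  have "norm (space_grad \<phi> p) \<le> (\<Sum>i\<in>UNIV. B i)" for p
    using norm_le_l1_cart[of "space_grad \<phi> p"] sum_mono[OF B]
    by (force simp: space_grad_def intro: order_trans)
  moreover have "space_grad \<phi> \<in> borel_measurable (lebesgue_on D)"
    unfolding space_grad_def[abs_def]
    by (intro continuous_borel_measurable_lebesgue_on continuous_on_vec_lambda
        continuous_derivative_test_function[OF assms])
  ultimately show ?thesis by (intro in_Linf_I AE_I2)
qed

section \<open>Stability of the linear system under weak convergence\<close>

lemma bounded_bilinear_matrix_vector_mult:
  "bounded_bilinear (\<lambda>(A :: real ^ 'n::finite ^ 'm::finite) v. A *v v)"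
  unfolding bilinear_conv_bounded_bilinear[symmetric] bilinear_def
  by (auto intro!: linearI simp: matrix_vector_mult_add_rdistrib matrix_vector_right_distrib
      matrix_vector_mult_scaleR scaleR_matrix_vector_assoc)

text \<open>Each pairing is bilinear in the field and a bounded derivative of the test function.\<close>

lemma
  assumes \<phi>: "test_function N g T C \<phi>"
  shows tendsto_dist_dt: "\<And>u ub. weakly_converges_L1 (lebesgue_on D) u ub \<Longrightarrow>
      (\<lambda>k. dist_dt D (u k) \<phi>) \<longlonglongrightarrow> dist_dt D ub \<phi>"
    and tendsto_dist_div: "\<And>u ub. weakly_converges_L1 (lebesgue_on D) u ub \<Longrightarrow>
      (\<lambda>k. dist_div D (u k) \<phi>) \<longlonglongrightarrow> dist_div D ub \<phi>"
    and tendsto_dist_div_mat: "\<And>u ub. weakly_converges_L1 (lebesgue_on D) u ub \<Longrightarrow>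
      (\<lambda>k. dist_div_mat D (u k) \<phi>) \<longlonglongrightarrow> dist_div_mat D ub \<phi>"
    and tendsto_dist_grad: "\<And>u ub. weakly_converges_L1 (lebesgue_on D) u ub \<Longrightarrow>
      (\<lambda>k. dist_grad D (u k) \<phi>) \<longlonglongrightarrow> dist_grad D ub \<phi>"
  unfolding dist_dt_def dist_div_def dist_div_mat_def dist_grad_def
  by (intro tendsto_minus
      weakly_converges_L1_bilinear[OF bounded_bilinear.flip[OF bounded_bilinear_scaleR] in_Linf_time_deriv[OF \<phi>]]
      weakly_converges_L1_bilinear[OF bounded_bilinear_inner in_Linf_space_grad[OF \<phi>]]
      weakly_converges_L1_bilinear[OF bounded_bilinear_scaleR in_Linf_space_grad[OF \<phi>]]
      weakly_converges_L1_bilinear[OF bounded_bilinear_matrix_vector_mult in_Linf_space_grad[OF \<phi>]];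
      assumption)+

lemma weakly_converges_L1_components:
  assumes "weakly_converges_L1 M z zb"
  shows "weakly_converges_L1 M (\<lambda>k p. fst (z k p)) (\<lambda>p. fst (zb p))"
    and "weakly_converges_L1 M (\<lambda>k p. snd (z k p)) (\<lambda>p. snd (zb p))"
  using weakly_converges_L1_bounded_linear[OF bounded_linear_fst assms]
    weakly_converges_L1_bounded_linear[OF bounded_linear_snd assms] by auto

lemma limit_of_constant:
  fixes f :: "nat \<Rightarrow> 'b::t2_space"
  assumes "f \<longlonglongrightarrow> a" and "\<And>k. f k = c"
  shows "a = c"
proof -
  have "f = (\<lambda>_. c)" using assms(2) by auto
  then show ?thesis using assms(1) by (simp add: LIMSEQ_const_iff)
qed

lemma relaxed_solution_weak_limit:
  fixes z :: "nat \<Rightarrow> 'n::finite point \<Rightarrow> 'n state"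
  assumes sol: "\<And>k. relaxed_solution N g T C (z k) (q k) (\<nu> k)"
    and z: "weakly_converges_L1 (lebesgue_on (spacetime N g T C)) z zb"
    and q: "weakly_converges_L1 (lebesgue_on (spacetime N g T C)) q qb"
    and \<nu>: "weakly_converges_measure N g T C \<nu> \<nu>b"
  shows "relaxed_solution N g T C zb qb \<nu>b"
  unfolding relaxed_solution_def Let_def case_prod_beta
proof (intro allI impI conjI)
  fix \<phi> assume \<phi>: "test_function N g T C \<phi>"
  let ?n = "real CARD('n)"
  note eqs = sol[unfolded relaxed_solution_def Let_def case_prod_beta, rule_format, OF \<phi>]
  note \<mu> = weakly_converges_L1_components(1)[OF z]
  note z1 = weakly_converges_L1_components(2)[OF z]
  note w = weakly_converges_L1_components(1)[OF z1]
  note z2 = weakly_converges_L1_components(2)[OF z1]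
  note m = weakly_converges_L1_components(1)[OF z2]
  note z3 = weakly_converges_L1_components(2)[OF z2]
  note h = weakly_converges_L1_components(1)[OF z3]
  note z4 = weakly_converges_L1_components(2)[OF z3]
  note \<sigma> = weakly_converges_L1_components(1)[OF z4]
  note e = weakly_converges_L1_components(2)[OF z4]
  note p = weakly_converges_L1_add[OF
      weakly_converges_L1_bounded_linear[OF bounded_linear_mult_right[of "2 / ?n"] e] q]
  show "dist_dt (spacetime N g T C) (\<lambda>p. fst (snd (snd (zb p)))) \<phi> +
       dist_div_mat (spacetime N g T C) (\<lambda>p. fst (snd (snd (snd (snd (zb p)))))) \<phi> +
       dist_grad (spacetime N g T C) (\<lambda>p. 2 / ?n * snd (snd (snd (snd (snd (zb p))))) + qb p) \<phi> = 0"
    using tendsto_add[OF tendsto_add[OF tendsto_dist_dt[OF \<phi> m] tendsto_dist_div_mat[OF \<phi> \<sigma>]]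
        tendsto_dist_grad[OF \<phi> p]]
    by (rule limit_of_constant) (use eqs in blast)
  show "dist_div (spacetime N g T C) (\<lambda>p. fst (snd (zb p))) \<phi> = 0"
    using tendsto_dist_div[OF \<phi> w] by (rule limit_of_constant) (use eqs in blast)
  show "dist_dt (spacetime N g T C) (\<lambda>p. fst (zb p)) \<phi> +
       dist_div (spacetime N g T C) (\<lambda>p. fst (snd (snd (zb p)))) \<phi> = 0"
    using tendsto_add[OF tendsto_dist_dt[OF \<phi> \<mu>] tendsto_dist_div[OF \<phi> m]]
    by (rule limit_of_constant) (use eqs in blast)
  have "(\<lambda>k. measure_pairing (\<nu> k) \<phi>) \<longlonglongrightarrow> measure_pairing \<nu>b \<phi>"
    using \<nu> \<phi> by (simp add: weakly_converges_measure_def test_function_def)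
  then show "dist_dt (spacetime N g T C) (\<lambda>p. snd (snd (snd (snd (snd (zb p)))))) \<phi> +
       dist_div (spacetime N g T C) (\<lambda>p. fst (snd (snd (snd (zb p))))) \<phi> = measure_pairing \<nu>b \<phi>"
    using tendsto_add[OF tendsto_dist_dt[OF \<phi> e] tendsto_dist_div[OF \<phi> h]]
    using eqs by (simp add: LIMSEQ_unique)
qed

text \<open>
  An Euler flow is a relaxed solution once the nonlinear terms are renamed: since \<open>\<sigma>\<close> is traceless,
  the trace of its defining identity says \<open>e = 1/2 \<mu> |w|\<^sup>2\<close>, and the isotropic part \<open>2/n e\<close> of the
  momentum flux moves into the pressure.
\<close>

lemma euler_solution_imp_relaxed_solution:
  fixes N :: "'n::finite" and g T :: real and C :: "'n container"
    and w m h :: "'n point \<Rightarrow> real ^ 'n"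
  defines "D \<equiv> spacetime N g T C"
  assumes sol: "euler_solution N g T C \<mu> w q \<nu>"
    and meas: "\<mu> \<in> borel_measurable (lebesgue_on D)" "w \<in> borel_measurable (lebesgue_on D)"
    and intz: "integrable (lebesgue_on D) (\<lambda>p. (\<mu> p, w p, m p, h p, \<sigma> p, e p))"
    and intq: "integrable (lebesgue_on D) q"
    and m: "AE p in lebesgue_on D. m p = \<mu> p *\<^sub>R w p"
    and h: "AE p in lebesgue_on D. h p = (e p + q p) *\<^sub>R w p"
    and \<sigma>: "AE p in lebesgue_on D. trace (\<sigma> p) = 0 \<and>
           \<mu> p *\<^sub>R outer (w p) (w p) = \<sigma> p + (2 / real CARD('n) * e p) *\<^sub>R mat 1"
  shows "relaxed_solution N g T C (\<lambda>p. (\<mu> p, w p, m p, h p, \<sigma> p, e p)) q \<nu>"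
  unfolding relaxed_solution_def Let_def case_prod_conv D_def[symmetric]
proof (intro allI impI)
  fix \<phi> assume \<phi>: "test_function N g T C \<phi>"
  let ?M = "lebesgue_on D"
  let ?c = "2 / real CARD('n)"
  note eqs = sol[unfolded euler_solution_def Let_def, folded D_def, THEN conjunct2, THEN conjunct2,
      rule_format, OF \<phi>]
  note snds = integrable_bounded_linear[OF bounded_linear_snd]
  note fsts = integrable_bounded_linear[OF bounded_linear_fst]
  have int: "integrable ?M m" "integrable ?M h" "integrable ?M \<sigma>" "integrable ?M e"
    using fsts[OF snds[OF snds[OF intz]]] fsts[OF snds[OF snds[OF snds[OF intz]]]]
      fsts[OF snds[OF snds[OF snds[OF snds[OF intz]]]]] snds[OF snds[OF snds[OF snds[OF snds[OF intz]]]]]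
    by simp_all
  note [measurable] = meas borel_measurable_integrable[OF intq]
    int[THEN borel_measurable_integrable]
  have dt[measurable]: "time_deriv \<phi> \<in> borel_measurable ?M" and G: "in_Linf ?M (space_grad \<phi>)"
    using in_Linf_time_deriv[OF \<phi>] in_Linf_space_grad[OF \<phi>] by (auto simp: in_Linf_def)
  then have [measurable]: "space_grad \<phi> \<in> borel_measurable ?M" by (simp add: in_Linf_def)
  have e: "AE p in ?M. 1/2 * \<mu> p * (norm (w p))\<^sup>2 = e p"
    using \<sigma>
  proof eventually_elim
    case (elim p)
    have "trace (\<mu> p *\<^sub>R outer (w p) (w p)) = \<mu> p * (norm (w p))\<^sup>2"
      by (simp add: trace_def outer_def power2_norm_eq_inner inner_vec_def sum_distrib_left)
    moreover have "trace (\<sigma> p + (?c * e p) *\<^sub>R mat 1) = 2 * e p"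
      using elim by (simp add: trace_def mat_def sum.distrib)
    ultimately show ?case using elim by simp
  qed
  have "dist_dt D (\<lambda>p. \<mu> p *\<^sub>R w p) \<phi> = dist_dt D m \<phi>"
    unfolding dist_dt_def using m by (intro arg_cong[where f=uminus] integral_cong_AE) auto
  moreover have "dist_div D (\<lambda>p. \<mu> p *\<^sub>R w p) \<phi> = dist_div D m \<phi>"
    unfolding dist_div_def using m by (intro arg_cong[where f=uminus] integral_cong_AE) auto
  moreover have "dist_dt D (\<lambda>p. 1/2 * \<mu> p * (norm (w p))\<^sup>2) \<phi> = dist_dt D e \<phi>"
    unfolding dist_dt_def using e by (intro arg_cong[where f=uminus] integral_cong_AE) auto
  moreover have "dist_div D (\<lambda>p. (1/2 * \<mu> p * (norm (w p))\<^sup>2 + q p) *\<^sub>R w p) \<phi> = dist_div D h \<phi>"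
    unfolding dist_div_def
  proof (intro arg_cong[where f=uminus] integral_cong_AE)
    show "AE p in ?M. ((1/2 * \<mu> p * (norm (w p))\<^sup>2 + q p) *\<^sub>R w p) \<bullet> space_grad \<phi> p
        = h p \<bullet> space_grad \<phi> p"
      using e h by eventually_elim simp
  qed measurable
  moreover have "dist_div_mat D (\<lambda>p. \<mu> p *\<^sub>R outer (w p) (w p)) \<phi> + dist_grad D q \<phi>
      = dist_div_mat D \<sigma> \<phi> + dist_grad D (\<lambda>p. ?c * e p + q p) \<phi>"
  proof -
    \<comment> \<open>Integrability of the momentum flux comes only through \<open>\<sigma>\<close> and \<open>e\<close>, so the flux is replaced
      by them before any integral is split.\<close>
    have outer: "(a *\<^sub>R outer u u) *v x = (a * (u \<bullet> x)) *\<^sub>R u" for a u and x :: "real ^ 'n"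
      by (simp add: matrix_vector_mult_scaleR_left outer_mult_vector)
    have i\<sigma>: "integrable ?M (\<lambda>p. \<sigma> p *v space_grad \<phi> p)"
      by (rule integrable_bilinear_Linf[OF bounded_bilinear_matrix_vector_mult G int(3)])
    have ie: "integrable ?M (\<lambda>p. (?c * e p) *\<^sub>R space_grad \<phi> p)"
      by (rule integrable_bilinear_Linf[OF bounded_bilinear_scaleR G]) (use int(4) in simp)
    have iq: "integrable ?M (\<lambda>p. q p *\<^sub>R space_grad \<phi> p)"
      by (rule integrable_bilinear_Linf[OF bounded_bilinear_scaleR G intq])
    have "(LINT p|?M. (\<mu> p *\<^sub>R outer (w p) (w p)) *v space_grad \<phi> p)
        = (LINT p|?M. \<sigma> p *v space_grad \<phi> p + (?c * e p) *\<^sub>R space_grad \<phi> p)"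
      unfolding outer
    proof (rule integral_cong_AE)
      show "AE p in ?M. (\<mu> p * (w p \<bullet> space_grad \<phi> p)) *\<^sub>R w p
          = \<sigma> p *v space_grad \<phi> p + (?c * e p) *\<^sub>R space_grad \<phi> p"
        using \<sigma>
      proof eventually_elim
        case (elim p)
        have "(\<mu> p * (w p \<bullet> space_grad \<phi> p)) *\<^sub>R w p
            = (\<mu> p *\<^sub>R outer (w p) (w p)) *v space_grad \<phi> p"
          by (simp add: outer)
        also have "\<dots> = (\<sigma> p + (?c * e p) *\<^sub>R mat 1) *v space_grad \<phi> p"
          using elim by simp
        finally show ?case
          by (simp add: matrix_vector_mult_add_rdistrib matrix_vector_mult_scaleR_left)
      qed
      show "(\<lambda>p. \<sigma> p *v space_grad \<phi> p + (?c * e p) *\<^sub>R space_grad \<phi> p) \<in> borel_measurable ?M"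
        using i\<sigma> ie by auto
    qed measurable
    then show ?thesis
      using i\<sigma> ie iq by (simp add: dist_div_mat_def dist_grad_def scaleR_add_left)
  qed
  ultimately show "dist_dt D m \<phi> + dist_div_mat D \<sigma> \<phi> + dist_grad D (\<lambda>p. ?c * e p + q p) \<phi> = 0 \<and>
         dist_div D w \<phi> = 0 \<and>
         dist_dt D \<mu> \<phi> + dist_div D m \<phi> = 0 \<and>
         dist_dt D e \<phi> + dist_div D h \<phi> = measure_pairing \<nu> \<phi>"
    using eqs by (simp add: add.assoc)
qed

section \<open>Bounds for the kinetic energies of the two fluids\<close>

text \<open>
  For \<open>\<rho>m < \<mu> < \<rho>p\<close> the vectors \<open>(m - \<rho>m w) / (\<mu> - \<rho>m)\<close> and \<open>(m - \<rho>p w) / (\<mu> - \<rho>p)\<close> are the mean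
  velocities of the heavy and of the light fluid in the mixture, and \<open>T_\<plusminus>\<close> are the kinetic energy
  densities of motion with these velocities. The set below bounds both velocities by \<open>W\<close>; with the
  denominators multiplied out, the bounds are convex in the state and still make sense for
  \<open>\<mu> = \<rho>m\<close> and \<open>\<mu> = \<rho>p\<close>, where the Euler states live.
\<close>

definition phase_velocity_bounds :: "real \<Rightarrow> real \<Rightarrow> real \<Rightarrow> 'n::finite state set" where
  "phase_velocity_bounds \<rho>m \<rho>p W =
     {z. norm (fst (snd (snd z)) - \<rho>m *\<^sub>R fst (snd z)) \<le> W * (fst z - \<rho>m) \<and>
         norm (fst (snd (snd z)) - \<rho>p *\<^sub>R fst (snd z)) \<le> W * (\<rho>p - fst z)}"

lemma closed_phase_velocity_bounds: "closed (phase_velocity_bounds \<rho>m \<rho>p W)"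
  unfolding phase_velocity_bounds_def
  by (intro closed_Collect_conj closed_Collect_le continuous_intros)

lemma convex_phase_velocity_bounds:
  "convex (phase_velocity_bounds \<rho>m \<rho>p W :: 'n::finite state set)"
proof (rule convexI)
  fix x y :: "'n state" and s t :: real
  assume x: "x \<in> phase_velocity_bounds \<rho>m \<rho>p W" and y: "y \<in> phase_velocity_bounds \<rho>m \<rho>p W"
    and st: "0 \<le> s" "0 \<le> t" "s + t = 1"
  have comb: "norm (s *\<^sub>R a + t *\<^sub>R b) \<le> s * \<alpha> + t * \<beta>" if "norm a \<le> \<alpha>" "norm b \<le> \<beta>"
    for a b :: "real ^ 'n" and \<alpha> \<beta>
    using norm_triangle_ineq[of "s *\<^sub>R a" "t *\<^sub>R b"] mult_left_mono[OF that(1) st(1)]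
      mult_left_mono[OF that(2) st(2)] st by simp
  have t: "t = 1 - s" using st by simp
  have lin: "s *\<^sub>R (m - \<rho> *\<^sub>R w) + t *\<^sub>R (m' - \<rho> *\<^sub>R w') = (s *\<^sub>R m + t *\<^sub>R m') - \<rho> *\<^sub>R (s *\<^sub>R w + t *\<^sub>R w')"
    for m m' w w' :: "real ^ 'n" and \<rho>
    by (simp add: algebra_simps)
  have "s * (W * (fst x - \<rho>m)) + t * (W * (fst y - \<rho>m)) = W * (s * fst x + t * fst y - \<rho>m)"
    "s * (W * (\<rho>p - fst x)) + t * (W * (\<rho>p - fst y)) = W * (\<rho>p - (s * fst x + t * fst y))"
    unfolding t by (simp_all add: algebra_simps)
  then show "s *\<^sub>R x + t *\<^sub>R y \<in> phase_velocity_bounds \<rho>m \<rho>p W"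
    using comb[of "fst (snd (snd x)) - \<rho>m *\<^sub>R fst (snd x)" "W * (fst x - \<rho>m)"
        "fst (snd (snd y)) - \<rho>m *\<^sub>R fst (snd y)" "W * (fst y - \<rho>m)"]
      comb[of "fst (snd (snd x)) - \<rho>p *\<^sub>R fst (snd x)" "W * (\<rho>p - fst x)"
        "fst (snd (snd y)) - \<rho>p *\<^sub>R fst (snd y)" "W * (\<rho>p - fst y)"] x y
    unfolding lin by (simp add: phase_velocity_bounds_def)
qed

lemma euler_state_in_phase_velocity_bounds:
  assumes "\<rho>m < \<rho>p" "\<mu> \<in> {\<rho>m, \<rho>p}" "norm w \<le> W"
  shows "(\<mu>, w, \<mu> *\<^sub>R w, h, \<sigma>, e) \<in> phase_velocity_bounds \<rho>m \<rho>p W"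
proof -
  have "norm (\<rho>p *\<^sub>R w - \<rho>m *\<^sub>R w) \<le> W * (\<rho>p - \<rho>m)" "norm (\<rho>m *\<^sub>R w - \<rho>p *\<^sub>R w) \<le> W * (\<rho>p - \<rho>m)"
    using assms mult_right_mono[of "norm w" W "\<rho>p - \<rho>m"]
    by (simp_all add: mult.commute flip: scaleR_diff_left)
  then show ?thesis using assms(2) by (auto simp: phase_velocity_bounds_def)
qed

text \<open>
  The light fluid even obeys the bound with \<open>\<rho>m\<close> in place of \<open>\<rho>p\<close>, its energy carrying the smaller
  density; the common bound is the one for the heavy fluid.
\<close>

lemma T_bounds:
  assumes \<rho>: "0 < \<rho>m" "\<rho>m < \<rho>p" and z: "z \<in> phase_velocity_bounds \<rho>m \<rho>p W"
    and \<mu>: "\<rho>m < fst z" "fst z < \<rho>p"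
  shows "\<bar>T_plus \<rho>m \<rho>p z\<bar> \<le> \<rho>p / 2 * W\<^sup>2" and "\<bar>T_minus \<rho>m \<rho>p z\<bar> \<le> \<rho>p / 2 * W\<^sup>2"
proof -
  have ratio: "0 \<le> (norm x)\<^sup>2 / a\<^sup>2 \<and> (norm x)\<^sup>2 / a\<^sup>2 \<le> W\<^sup>2"
    if "norm x \<le> W * \<bar>a\<bar>" "a \<noteq> 0" for x :: "real ^ 'a" and a :: real
  proof -
    have "(norm x)\<^sup>2 \<le> (W * \<bar>a\<bar>)\<^sup>2" using that(1) by (intro power_mono) auto
    then show ?thesis using that(2) by (simp add: divide_le_eq power_mult_distrib)
  qed
  define r where "r = (norm (fst (snd (snd z)) - \<rho>m *\<^sub>R fst (snd z)))\<^sup>2 / (fst z - \<rho>m)\<^sup>2"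
  define s where "s = (norm (fst (snd (snd z)) - \<rho>p *\<^sub>R fst (snd z)))\<^sup>2 / (fst z - \<rho>p)\<^sup>2"
  have r: "0 \<le> r \<and> r \<le> W\<^sup>2"
    unfolding r_def using z \<mu> by (intro ratio) (auto simp: phase_velocity_bounds_def)
  have s: "0 \<le> s \<and> s \<le> W\<^sup>2"
    unfolding s_def using z \<mu> by (intro ratio) (auto simp: phase_velocity_bounds_def)
  have "T_plus \<rho>m \<rho>p z = \<rho>p / 2 * r"
    by (simp add: T_plus_def r_def case_prod_beta)
  moreover have "\<rho>p / 2 * r \<le> \<rho>p / 2 * W\<^sup>2"
    using r \<rho> by (intro mult_left_mono) auto
  moreover have "0 \<le> \<rho>p / 2 * r" using r \<rho> by simp
  ultimately show "\<bar>T_plus \<rho>m \<rho>p z\<bar> \<le> \<rho>p / 2 * W\<^sup>2" by linarith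
  have "T_minus \<rho>m \<rho>p z = \<rho>m / 2 * s"
    by (simp add: T_minus_def s_def case_prod_beta)
  moreover have "\<rho>m / 2 * s \<le> \<rho>p / 2 * W\<^sup>2"
    using s \<rho> by (intro mult_mono) auto
  moreover have "0 \<le> \<rho>m / 2 * s" using s \<rho> by simp
  ultimately show "\<bar>T_minus \<rho>m \<rho>p z\<bar> \<le> \<rho>p / 2 * W\<^sup>2" by linarith
qed

lemma linf_norm_le:
  assumes "f \<in> borel_measurable M" "AE x in M. norm (f x) \<le> B" "ennreal B \<le> C"
  shows "linf_norm M f \<le> C"
  unfolding linf_norm_def using assms
  by (intro order_trans[OF esssup_I assms(3)]) (auto intro: ennreal_leI)

text \<open>
  The bound to be proved is stated with the supremum of the squared norms. Taking the square root of
  that supremum as the common velocity bound avoids interchanging the supremum with the square.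
\<close>

lemma AE_norm_le_of_linf_norm_square:
  assumes fin: "(SUP k. linf_norm M (f k)) < \<infinity>"
  defines "S \<equiv> SUP k. (linf_norm M (f k))\<^sup>2"
  shows "AE x in M. norm (f k x) \<le> sqrt (enn2real S)" and "ennreal ((sqrt (enn2real S))\<^sup>2) = S"
proof -
  have "S \<le> (SUP k. linf_norm M (f k))\<^sup>2"
    unfolding S_def by (intro SUP_least power_mono SUP_upper) auto
  also have "\<dots> < \<infinity>" using fin by (simp add: power_less_top_ennreal)
  finally have S: "S < \<infinity>" .
  then show eq: "ennreal ((sqrt (enn2real S))\<^sup>2) = S" by simp
  have "AE x in M. ennreal (norm (f k x)) \<le> linf_norm M (f k)"
    unfolding linf_norm_def by (rule esssup_AE)
  then show "AE x in M. norm (f k x) \<le> sqrt (enn2real S)"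
  proof eventually_elim
    case (elim x)
    have "ennreal ((norm (f k x))\<^sup>2) = (ennreal (norm (f k x)))\<^sup>2" by (simp add: ennreal_power)
    also have "\<dots> \<le> (linf_norm M (f k))\<^sup>2" using elim by (intro power_mono) auto
    also have "\<dots> \<le> S" unfolding S_def by (rule SUP_upper) simp
    finally have "enn2real (ennreal ((norm (f k x))\<^sup>2)) \<le> enn2real S"
      using S by (intro enn2real_mono) auto
    then show ?case by (intro real_le_rsqrt) simp
  qed
qed

section \<open>Weak limits of inhomogeneous Euler flows\<close>

theorem proposition1p7:
  fixes N :: "'n::finite" and g T \<rho>m \<rho>p :: real and C :: "'n container"
    and \<mu> e q :: "nat \<Rightarrow> 'n point \<Rightarrow> real"
    and w m h :: "nat \<Rightarrow> 'n point \<Rightarrow> real ^ 'n"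
    and \<sigma> :: "nat \<Rightarrow> 'n point \<Rightarrow> real ^ 'n ^ 'n"
    and \<nu> :: "nat \<Rightarrow> 'n signed_measure"
    and \<mu>b eb qb :: "'n point \<Rightarrow> real"
    and wb mb hb :: "'n point \<Rightarrow> real ^ 'n"
    and \<sigma>b :: "'n point \<Rightarrow> real ^ 'n ^ 'n"
    and \<nu>b :: "'n signed_measure"
  defines "D \<equiv> spacetime N g T C"
  defines "z \<equiv> \<lambda>k p. (\<mu> k p, w k p, m k p, h k p, \<sigma> k p, e k p)"
  defines "zb \<equiv> \<lambda>p. (\<mu>b p, wb p, mb p, hb p, \<sigma>b p, eb p)"
  assumes "CARD('n) \<in> {2, 3}" and "0 < g" and "0 < T" and "0 < \<rho>m" and "\<rho>m < \<rho>p"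
    and "admissible_container C"
    and "\<And>k. in_Linf (lebesgue_on D) (\<mu> k)"
    and "\<And>k. in_Lp 3 (lebesgue_on D) (w k)"
    and "\<And>k. euler_solution N g T C (\<mu> k) (w k) (q k) (\<nu> k)"
    and "\<And>k. AE p in lebesgue_on D. \<mu> k p \<in> {\<rho>m, \<rho>p}"
    and "\<And>k. AE p in lebesgue_on D. m k p = \<mu> k p *\<^sub>R w k p"
    and "\<And>k. AE p in lebesgue_on D. h k p = (e k p + q k p) *\<^sub>R w k p"
    and "\<And>k. AE p in lebesgue_on D. trace (\<sigma> k p) = 0 \<and>
           \<mu> k p *\<^sub>R outer (w k p) (w k p) = \<sigma> k p + (2 / real CARD('n) * e k p) *\<^sub>R mat 1"
    and "weakly_converges_L1 (lebesgue_on D) z zb"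
    and "weakly_converges_L1 (lebesgue_on D) q qb"
    and "signed_radon N g T C \<nu>b"
    and "weakly_converges_measure N g T C \<nu> \<nu>b"
  shows "relaxed_solution N g T C zb qb \<nu>b \<and>
    (AE p in lebesgue_on D. zb p \<in> closure (relaxation_set \<rho>m \<rho>p)) \<and>
    ((SUP k. linf_norm (lebesgue_on D) (w k)) < \<infinity> \<longrightarrow>
       (let S = {p \<in> D. \<rho>m < \<mu>b p \<and> \<mu>b p < \<rho>p};
            B = ennreal (\<rho>p / 2) * (SUP k. (linf_norm (lebesgue_on D) (w k))\<^sup>2)
        in in_Linf (lebesgue_on S) (\<lambda>p. T_plus \<rho>m \<rho>p (zb p)) \<and>
           in_Linf (lebesgue_on S) (\<lambda>p. T_minus \<rho>m \<rho>p (zb p)) \<and>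
           linf_norm (lebesgue_on S) (\<lambda>p. T_plus \<rho>m \<rho>p (zb p)) \<le> B \<and>
           linf_norm (lebesgue_on S) (\<lambda>p. T_minus \<rho>m \<rho>p (zb p)) \<le> B))"
proof (intro conjI impI)
  note \<rho> = \<open>0 < \<rho>m\<close> \<open>\<rho>m < \<rho>p\<close>
  note \<mu> = \<open>\<And>k. AE p in lebesgue_on D. \<mu> k p \<in> {\<rho>m, \<rho>p}\<close>
  note m = \<open>\<And>k. AE p in lebesgue_on D. m k p = \<mu> k p *\<^sub>R w k p\<close>
  note h = \<open>\<And>k. AE p in lebesgue_on D. h k p = (e k p + q k p) *\<^sub>R w k p\<close>
  note \<sigma> = \<open>\<And>k. AE p in lebesgue_on D. trace (\<sigma> k p) = 0 \<and>
           \<mu> k p *\<^sub>R outer (w k p) (w k p) = \<sigma> k p + (2 / real CARD('n) * e k p) *\<^sub>R mat 1\<close>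
  note z = \<open>weakly_converges_L1 (lebesgue_on D) z zb\<close>
  note q = \<open>weakly_converges_L1 (lebesgue_on D) q qb\<close>
  have D: "D \<in> sets lebesgue"
    unfolding D_def by (rule spacetime_in_lebesgue) fact
  note sf = sigma_finite_lebesgue_on[OF D]
  have "relaxed_solution N g T C (z k) (q k) (\<nu> k)" for k
    unfolding z_def
  proof (rule euler_solution_imp_relaxed_solution; (fold D_def)?)
    show "\<mu> k \<in> borel_measurable (lebesgue_on D)" "w k \<in> borel_measurable (lebesgue_on D)"
      using assms(10,11) by (auto simp: in_Linf_def in_Lp_def)
    show "integrable (lebesgue_on D) (\<lambda>p. (\<mu> k p, w k p, m k p, h k p, \<sigma> k p, e k p))"
      "integrable (lebesgue_on D) (q k)"
      using z q by (auto simp: weakly_converges_L1_def z_def)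
  qed (fact assms m h \<sigma>)+
  then show "relaxed_solution N g T C zb qb \<nu>b"
    using z q unfolding D_def by (rule relaxed_solution_weak_limit) fact
  have "AE p in lebesgue_on D. z k p \<in> closure (relaxation_set \<rho>m \<rho>p)" for k
    using \<mu>[of k] m[of k] \<sigma>[of k]
    by eventually_elim
      (unfold z_def, metis euler_state_in_closure_relaxation_set[OF \<rho>])
  from weak_limit_AE_closed_convex[OF sf z closed_closure
      convex_closure[OF convex_relaxation_set[OF \<rho>]] this]
  show "AE p in lebesgue_on D. zb p \<in> closure (relaxation_set \<rho>m \<rho>p)" .
  assume fin: "(SUP k. linf_norm (lebesgue_on D) (w k)) < \<infinity>"
  define W where "W = sqrt (enn2real (SUP k. (linf_norm (lebesgue_on D) (w k))\<^sup>2))"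
  define S where "S = {p \<in> D. \<rho>m < \<mu>b p \<and> \<mu>b p < \<rho>p}"
  define B where "B = ennreal (\<rho>p / 2) * (SUP k. (linf_norm (lebesgue_on D) (w k))\<^sup>2)"
  have W: "AE p in lebesgue_on D. norm (w k p) \<le> W" for k
    unfolding W_def by (rule AE_norm_le_of_linf_norm_square(1)[OF fin])
  have "ennreal (\<rho>p / 2 * W\<^sup>2) = ennreal (\<rho>p / 2) * ennreal (W\<^sup>2)"
    using \<rho> by (intro ennreal_mult) auto
  also have "\<dots> = B"
    unfolding B_def W_def by (simp only: AE_norm_le_of_linf_norm_square(2)[OF fin])
  finally have B: "ennreal (\<rho>p / 2 * W\<^sup>2) = B" .
  have "AE p in lebesgue_on D. z k p \<in> phase_velocity_bounds \<rho>m \<rho>p W" for k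
    using \<mu>[of k] m[of k] W[of k]
    by eventually_elim
      (unfold z_def, metis euler_state_in_phase_velocity_bounds[OF \<rho>(2)])
  note zb = weak_limit_AE_closed_convex[OF sf z closed_phase_velocity_bounds
      convex_phase_velocity_bounds this]
  have zb_meas: "zb \<in> borel_measurable (lebesgue_on D)"
    using z by (auto simp: weakly_converges_L1_def)
  have "(\<lambda>p. fst (zb p)) \<in> borel_measurable (lebesgue_on D)"
    "(\<lambda>p. fst (snd (zb p))) \<in> borel_measurable (lebesgue_on D)"
    "(\<lambda>p. fst (snd (snd (zb p)))) \<in> borel_measurable (lebesgue_on D)"
    by (intro borel_measurable_continuous_on[OF _ zb_meas] continuous_intros)+
  then have comps: "\<mu>b \<in> borel_measurable (lebesgue_on D)" "wb \<in> borel_measurable (lebesgue_on D)"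
    "mb \<in> borel_measurable (lebesgue_on D)"
    by (simp_all add: zb_def)
  from comps(1) have "{p \<in> space (lebesgue_on D). \<rho>m < \<mu>b p \<and> \<mu>b p < \<rho>p} \<in> sets (lebesgue_on D)"
    by measurable
  then have S: "S \<in> sets lebesgue" using D by (simp add: S_def sets_restrict_space_iff)
  have "S \<subseteq> D" by (auto simp: S_def)
  then have [measurable]: "\<mu>b \<in> borel_measurable (lebesgue_on S)"
    "wb \<in> borel_measurable (lebesgue_on S)" "mb \<in> borel_measurable (lebesgue_on S)"
    using comps by (auto intro: measurable_restrict_mono)
  have meas: "(\<lambda>p. T_plus \<rho>m \<rho>p (zb p)) \<in> borel_measurable (lebesgue_on S)"
    "(\<lambda>p. T_minus \<rho>m \<rho>p (zb p)) \<in> borel_measurable (lebesgue_on S)"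
    unfolding T_plus_def T_minus_def zb_def case_prod_conv by measurable
  have "AE p in lebesgue_on S. zb p \<in> phase_velocity_bounds \<rho>m \<rho>p W \<and> p \<in> S"
    using zb D S by (auto simp: AE_restrict_space_iff S_def)
  then have "AE p in lebesgue_on S. norm (T_plus \<rho>m \<rho>p (zb p)) \<le> \<rho>p / 2 * W\<^sup>2 \<and>
      norm (T_minus \<rho>m \<rho>p (zb p)) \<le> \<rho>p / 2 * W\<^sup>2"
  proof eventually_elim
    case (elim p)
    then have "\<rho>m < fst (zb p)" "fst (zb p) < \<rho>p" by (auto simp: S_def zb_def)
    then show ?case using T_bounds[OF \<rho>, of "zb p" W] elim by simp
  qed
  then have "AE p in lebesgue_on S. norm (T_plus \<rho>m \<rho>p (zb p)) \<le> \<rho>p / 2 * W\<^sup>2"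
    "AE p in lebesgue_on S. norm (T_minus \<rho>m \<rho>p (zb p)) \<le> \<rho>p / 2 * W\<^sup>2"
    by auto
  then have "in_Linf (lebesgue_on S) (\<lambda>p. T_plus \<rho>m \<rho>p (zb p))"
    "in_Linf (lebesgue_on S) (\<lambda>p. T_minus \<rho>m \<rho>p (zb p))"
    "linf_norm (lebesgue_on S) (\<lambda>p. T_plus \<rho>m \<rho>p (zb p)) \<le> B"
    "linf_norm (lebesgue_on S) (\<lambda>p. T_minus \<rho>m \<rho>p (zb p)) \<le> B"
    using meas by (blast intro: in_Linf_I linf_norm_le eq_refl[OF B])+
  then show "let S = {p \<in> D. \<rho>m < \<mu>b p \<and> \<mu>b p < \<rho>p};
            B = ennreal (\<rho>p / 2) * (SUP k. (linf_norm (lebesgue_on D) (w k))\<^sup>2)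
        in in_Linf (lebesgue_on S) (\<lambda>p. T_plus \<rho>m \<rho>p (zb p)) \<and>
           in_Linf (lebesgue_on S) (\<lambda>p. T_minus \<rho>m \<rho>p (zb p)) \<and>
           linf_norm (lebesgue_on S) (\<lambda>p. T_plus \<rho>m \<rho>p (zb p)) \<le> B \<and>
           linf_norm (lebesgue_on S) (\<lambda>p. T_minus \<rho>m \<rho>p (zb p)) \<le> B"
    unfolding Let_def S_def[symmetric] B_def[symmetric]
    by blast
qed

end
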